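(* Let $N\ge1$ be an integer and $0<a,q<1$. Let $L$ be the last passage time of the directed last passage percolation model on the cylinder of width $2N$ in which the unit squares of horizontal slice $k\ge 1$ carry independent $\mathrm{Geom}(aq^k)$ weights (model defined in the context). Let $\lambda_1$ be the largest part of the central partition $\lambda=\lambda^{(0)}$ of a random cylindric plane partition $\Lambda=\{\mu=\lambda^{(-N)}\prec\cdots\prec\lambda^{(0)}=\lambda\succ\cdots\succ\lambda^{(N)}=\mu\}$ with distribution $$\mathbb{P}(\Lambda)=\frac1Z\,a^{|\lambda|}(a^{-1}q^{-N})^{|\mu|}q^{\sum_{i=-N}^{N-1}|\lambda^{(i)}|},$$ where $Z$ is the normalizing constant. Let $\chi$ be a nonnegative-integer-valued random variable independent of $L$ with $\mathbb{P}(\chi\le m)=(q^{N(m+1)};q^N)_\infty$ for all integers $m\ge0$. Then $$L+\chi=\lambda_1\quad\text{in distribution}.$$ Moreover, $\chi$ has the distribution of the first part $\kappa_1$ of a random integer partition $\kappa$ with $\mathbb{P}(\kappa)=(q^N;q^N)_\infty\,(q^N)^{|\kappa|}$.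
   Context: An (integer) partition $\lambda=(\lambda_1\ge\lambda_2\ge\cdots\ge0)$ has finitely many nonzero parts, which are positive integers; $|\lambda|=\sum_i\lambda_i$. Interlacing $\mu\prec\lambda$ (equivalently $\lambda\succ\mu$) means $\lambda_1\ge\mu_1\ge\lambda_2\ge\mu_2\ge\cdots$. A cylindric plane partition of width $2N$ is a sequence of partitions $\lambda^{(-N)}\prec\cdots\prec\lambda^{(-1)}\prec\lambda^{(0)}\succ\lambda^{(1)}\succ\cdots\succ\lambda^{(N)}$ with $\lambda^{(-N)}=\lambda^{(N)}=\mu$. Notation: $(x;u)_\infty=\prod_{i\ge0}(1-xu^i)$. The normalizing constant is $Z=(q^N;q^N)_\infty^{-1}\prod_{1\le i,j\le N}(aq^{i+j-1};q^N)_\infty^{-1}$. Last passage percolation model. A random variable $X$ is $\mathrm{Geom}(t)$ if $\mathbb{P}(X=k)=(1-t)t^k$ for $k=0,1,2,\dots$. The domain is a half-infinite cylinder of circumference $2N$ (left and right vertical sides identified), tiled by unit squares rotated by 45 degrees, starting from a single top-most square. In coordinates: squares are indexed by $(h,k)$, where $k\ge1$ is the index of the horizontal slice (row, increasing downward) and $h\in\mathbb{Z}/2N\mathbb{Z}$ is the horizontal position of the center. For $1\le k\le N$ slice $k$ consists of the squares with $h\in\{-(k-1),-(k-3),\dots,k-3,k-1\}$ mod $2N$; for $k\ge N$ slice $k$ consists of all squares with $h\in\mathbb{Z}/2N\mathbb{Z}$, $h\equiv k-1\pmod 2$. Thus slice $k$ contains $\min(k,N)$ squares and the top-most square is $(0,1)$.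 All squares carry independent random weights, and those in slice $k$ have distribution $\mathrm{Geom}(aq^k)$. Admissible paths start at the top-most square and go down to infinity using steps $(h,k)\to(h\pm1,k+1)$ (unit down-right or down-left steps on the cylinder). The length of a path is the sum of the weights of the squares it visits, and $L$ is the maximal length over all admissible paths; almost surely only finitely many weights are nonzero, so $L<\infty$ almost surely. *)

theory Defs
  imports "HOL-Probability.Probability" "HOL-Number_Theory.Cong"
begin

section \<open>Partitions\<close>

text \<open>
  A partition \<open>\<lambda>\<^sub>1 \<ge> \<lambda>\<^sub>2 \<ge> \<dots> \<ge> 0\<close> is a function on \<open>nat\<close> with the parts indexed from 0, so that
  the largest part \<open>\<lambda>\<^sub>1\<close> is \<open>l 0\<close>.
\<close>

definition partitions :: "(nat \<Rightarrow> nat) set" where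
  "partitions = {l. antimono l \<and> finite {i. l i \<noteq> 0}}"

definition psize :: "(nat \<Rightarrow> nat) \<Rightarrow> nat" where
  "psize l = (\<Sum>i | l i \<noteq> 0. l i)"

definition interlaces :: "(nat \<Rightarrow> nat) \<Rightarrow> (nat \<Rightarrow> nat) \<Rightarrow> bool" (infix "\<prec>" 50) where
  "m \<prec> l \<longleftrightarrow> (\<forall>i. m i \<le> l i \<and> l (Suc i) \<le> m i)"

definition qpoch :: "real \<Rightarrow> real \<Rightarrow> real" where
  "qpoch x u = (\<Prod>i. 1 - x * u ^ i)"


section \<open>Cylindric plane partitions\<close>

definition cylindric_plane_partitions :: "nat \<Rightarrow> (int \<Rightarrow> nat \<Rightarrow> nat) set" where
  "cylindric_plane_partitions N =
     {\<Lambda> \<in> {- int N..int N} \<rightarrow>\<^sub>E partitions.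
        (\<forall>i\<in>{- int N..<0}. \<Lambda> i \<prec> \<Lambda> (i + 1)) \<and>
        (\<forall>i\<in>{0..<int N}. \<Lambda> (i + 1) \<prec> \<Lambda> i) \<and>
        \<Lambda> (- int N) = \<Lambda> (int N)}"

definition cpp_weight :: "nat \<Rightarrow> real \<Rightarrow> real \<Rightarrow> (int \<Rightarrow> nat \<Rightarrow> nat) \<Rightarrow> real" where
  "cpp_weight N a q \<Lambda> =
     a ^ psize (\<Lambda> 0) * (inverse a * q powi (- int N)) ^ psize (\<Lambda> (int N)) *
     q ^ (\<Sum>i\<in>{- int N..<int N}. psize (\<Lambda> i))"

definition cpp_Z :: "nat \<Rightarrow> real \<Rightarrow> real \<Rightarrow> real" where
  "cpp_Z N a q =
     inverse (qpoch (q ^ N) (q ^ N)) *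
     (\<Prod>i\<in>{1..N}. \<Prod>j\<in>{1..N}. inverse (qpoch (a * q ^ (i + j - 1)) (q ^ N)))"

definition cpp_law :: "nat \<Rightarrow> real \<Rightarrow> real \<Rightarrow> (int \<Rightarrow> nat \<Rightarrow> nat) measure" where
  "cpp_law N a q =
     point_measure (cylindric_plane_partitions N) (\<lambda>\<Lambda>. ennreal (cpp_weight N a q \<Lambda> / cpp_Z N a q))"

definition partition_law :: "real \<Rightarrow> (nat \<Rightarrow> nat) measure" where
  "partition_law u = point_measure partitions (\<lambda>k. ennreal (qpoch u u * u ^ psize k))"


section \<open>Last passage percolation on the half-infinite cylinder\<close>

text \<open>The library's \<open>geometric_pmf\<close> is parametrised by the success probability \<open>1 - t\<close>.\<close>

definition Geom :: "real \<Rightarrow> nat pmf" where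
  "Geom t = geometric_pmf (1 - t)"

lemma pmf_Geom: "0 \<le> t \<Longrightarrow> t < 1 \<Longrightarrow> pmf (Geom t) k = (1 - t) * t ^ k"
  by (simp add: Geom_def)

text \<open>
  Horizontal positions, i.e. elements of \<open>\<int>/2N\<int>\<close>, are represented by the integers in \<open>{0..<2N}\<close>.
  The two cases below agree for \<open>k = N\<close>.
\<close>

definition slice :: "nat \<Rightarrow> nat \<Rightarrow> int set" where
  "slice N k =
     (if k \<le> N
      then (\<lambda>h. h mod (2 * int N)) ` {h. - (int k - 1) \<le> h \<and> h \<le> int k - 1 \<and> [h = int k - 1] (mod 2)}
      else {h \<in> {0..<2 * int N}. [h = int k - 1] (mod 2)})"

definition squares :: "nat \<Rightarrow> (int \<times> nat) set" where
  "squares N = {(h, k). 1 \<le> k \<and> h \<in> slice N k}"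

text \<open>A path is given by its position \<open>p k\<close> in slice \<open>k \<ge> 1\<close>; the value \<open>p 0\<close> plays no role.\<close>

definition paths :: "nat \<Rightarrow> (nat \<Rightarrow> int) set" where
  "paths N =
     {p. p 1 = 0 \<and>
         (\<forall>k\<ge>1. p (k + 1) = (p k + 1) mod (2 * int N) \<or> p (k + 1) = (p k - 1) mod (2 * int N))}"

definition path_length :: "(int \<times> nat \<Rightarrow> nat) \<Rightarrow> (nat \<Rightarrow> int) \<Rightarrow> enat" where
  "path_length w p = (\<Sum>k. enat (w (p (Suc k), Suc k)))"

text \<open>
  The supremum is taken in the extended naturals. It is an attained, finite maximum as soon as only
  finitely many weights are nonzero, which happens almost surely.
\<close>

definition last_passage_time :: "nat \<Rightarrow> (int \<times> nat \<Rightarrow> nat) \<Rightarrow> enat" where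
  "last_passage_time N w = (SUP p\<in>paths N. path_length w p)"

lemma path_in_squares:
  assumes "1 \<le> N" "p \<in> paths N" "1 \<le> k"
  shows "(p k, k) \<in> squares N"
  using assms(3)
proof (induction k rule: dec_induct)
  case base
  have "{h::int. - (int 1 - 1) \<le> h \<and> h \<le> int 1 - 1 \<and> [h = int 1 - 1] (mod 2)} = {0}"
    by auto
  then show ?case
    using assms by (simp add: squares_def slice_def paths_def)
next
  case (step k)
  let ?n = "2 * int N"
  have n: "?n > 0" using assms(1) by simp
  obtain e :: int where e: "e = 1 \<or> e = -1" and p: "p (Suc k) = (p k + e) mod ?n"
  proof -
    have "p (k + 1) = (p k + 1) mod ?n \<or> p (k + 1) = (p k - 1) mod ?n"
      using assms(2) step(1) unfolding paths_def by blast
    then show thesis using that[of 1] that[of "-1"] by auto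
  qed
  have mem: "p k \<in> slice N k"
    using step(3) by (simp add: squares_def)
  obtain h where h: "p k = h mod ?n" "[h = int k - 1] (mod 2)"
    "k \<le> N \<Longrightarrow> - (int k - 1) \<le> h \<and> h \<le> int k - 1"
  proof (cases "k \<le> N")
    case True
    then show thesis using mem that unfolding slice_def by auto
  next
    case False
    then show thesis using mem that[of "p k"] unfolding slice_def by auto
  qed
  have pk: "p (Suc k) = (h + e) mod ?n"
    by (simp add: p h(1) mod_simps)
  have par: "[h + e = int (Suc k) - 1] (mod 2)"
    using h(2) e unfolding cong_def by presburger
  have "p (Suc k) \<in> slice N (Suc k)"
  proof (cases "Suc k \<le> N")
    case True
    then have "- (int (Suc k) - 1) \<le> h + e \<and> h + e \<le> int (Suc k) - 1"
      using h(3) e by auto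
    then show ?thesis
      using True par unfolding slice_def pk by auto
  next
    case False
    have "[(h + e) mod ?n = h + e] (mod 2)"
      unfolding cong_def by (simp add: mod_mod_cancel)
    then have "[(h + e) mod ?n = int (Suc k) - 1] (mod 2)"
      using par cong_trans by blast
    then show ?thesis
      using False n unfolding slice_def pk by auto
  qed
  then show ?case by (simp add: squares_def)
qed

end

theory Submission
  imports Defs
begin

text \<open>
  The local growth rule of the Robinson--Schensted--Knuth correspondence replaces the partition at a
  peak, together with its neighbours \<open>\<mu>\<close> and \<open>\<nu>\<close>, by a smaller partition and a number \<open>G\<close>. The weight of
  the configuration turns \<open>G\<close> into an independent geometric variable, and the first part of the peak is
  \<open>max \<mu>\<^sub>1 \<nu>\<^sub>1 + G\<close>, which is the recursion of last passage percolation. Removing the squares of the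
  cylinder slice by slice pushes the profile to infinity. There the weights of all configurations
  that are not constant along the cycle vanish, while a constant one \<open>\<kappa>\<close> keeps the weight
  \<open>q ^ (N * |\<kappa>|)\<close>, so that \<open>\<lambda>\<^sub>1\<close> becomes \<open>L + \<kappa>\<^sub>1\<close>.
\<close>

(* lesspoll uses the same symbol, which makes every interlacing formula ambiguous to parse. *)
no_notation lesspoll (infixl "\<prec>" 50)

text \<open>A profile is encoded by a time \<open>t\<close> on the cycle whose neighbouring values
  differ by one: a peak of the partitions is a local minimum of \<open>t\<close>, and removing the
  square there raises \<open>t\<close> by 2. The weight depends on \<open>t\<close> alone, and a
  removal turns the weight for \<open>t\<close> into the weight for the raised \<open>t\<close>;
  hence a peak at time \<open>k - 1\<close> always releases the geometric parameter
  \<open>a * q ^ k\<close>. No coupling of partitions and percolation is constructed.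
  \<open>partition_fun n A m\<close> sums, over the configurations on the current profile, the
  weight times the probability of an event about the given variables \<open>w\<close>. Each removal
  trades a sum over \<open>G\<close> for one more square in that event, at the price of a factor
  \<open>1 / (1 - a * q ^ k)\<close>. The product of these factors tends to
  \<open>cpp_Z N a q * qpoch (q ^ N) (q ^ N)\<close>, whose second factor normalizes the law of
  \<open>\<kappa>\<close>. The obstacle is the exchange of limit and sum. A valley is no larger than
  its neighbours, so half of the power of \<open>q\<close> at the peaks can pay for the valleys;
  this gives a summable bound in powers of \<open>sqrt q\<close> that is uniform in the
  level.\<close>

lemma partitions_antimono: "l \<in> partitions \<Longrightarrow> i \<le> j \<Longrightarrow> l j \<le> l i"
  by (simp add: partitions_def antimono_def)

lemma partitions_eventually_zero:
  assumes "l \<in> partitions"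
  obtains n where "\<And>i. n \<le> i \<Longrightarrow> l i = 0"
proof -
  have "finite {i. l i \<noteq> 0}" using assms by (simp add: partitions_def)
  then obtain n where "{i. l i \<noteq> 0} \<subseteq> {..<n}"
    using finite_nat_iff_bounded by blast
  then have "l i = 0" if "n \<le> i" for i
    using that by (force simp: subset_eq)
  then show thesis by (rule that)
qed

lemma psize_eq_sum_lessThan:
  assumes "\<And>i. n \<le> i \<Longrightarrow> l i = 0"
  shows "psize l = (\<Sum>i<n. l i)"
  unfolding psize_def
proof (rule sum.mono_neutral_left)
  show "{i. l i \<noteq> 0} \<subseteq> {..<n}"
  proof
    fix i assume "i \<in> {i. l i \<noteq> 0}"
    then show "i \<in> {..<n}" using assms[of i] by (cases "n \<le> i") auto
  qed
qed auto

lemma partitionsI: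
  assumes "\<And>i. l (Suc i) \<le> l i" "\<And>i. n \<le> i \<Longrightarrow> l i = 0"
  shows "l \<in> partitions"
proof -
  have "{i. l i \<noteq> 0} \<subseteq> {..<n}"
  proof
    fix i assume "i \<in> {i. l i \<noteq> 0}"
    then show "i \<in> {..<n}" using assms(2)[of i] by (cases "n \<le> i") auto
  qed
  then have "finite {i. l i \<noteq> 0}" using finite_subset by blast
  moreover have "antimono l" using assms(1) by (rule decseq_SucI)
  ultimately show ?thesis by (simp add: partitions_def)
qed

lemma countable_partitions: "countable partitions"
proof (rule countable_subset)
  show "partitions \<subseteq> (\<lambda>xs i. if i < length xs then xs ! i else 0) ` (UNIV :: nat list set)"
  proof
    fix l assume "l \<in> partitions"
    then obtain n where "\<And>i. n \<le> i \<Longrightarrow> l i = 0" using partitions_eventually_zero by blast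
    then have "l = (\<lambda>i. if i < length (map l [0..<n]) then map l [0..<n] ! i else 0)"
      by (auto simp: fun_eq_iff not_less)
    then show "l \<in> (\<lambda>xs i. if i < length xs then xs ! i else 0) ` (UNIV :: nat list set)"
      by blast
  qed
qed auto

lemma interlaces_refl: "l \<in> partitions \<Longrightarrow> l \<prec> l"
  by (simp add: interlaces_def partitions_antimono)

lemma psize_mono:
  assumes "m \<in> partitions" "l \<in> partitions" "\<And>i. m i \<le> l i"
  shows "psize m \<le> psize l"
proof -
  obtain n where n: "\<And>i. n \<le> i \<Longrightarrow> l i = 0" using assms(2) partitions_eventually_zero by blast
  then have "\<And>i. n \<le> i \<Longrightarrow> m i = 0" using assms(3) by (metis le_zero_eq)
  with n show ?thesis by (simp only: psize_eq_sum_lessThan[of n] sum_mono assms(3))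
qed

text \<open>Serves to recognise constant configurations in the limit: between nested partitions
  equal sizes leave no room for a strict inequality.\<close>

lemma psize_mono_eq:
  assumes "m \<in> partitions" "l \<in> partitions" "\<And>i. m i \<le> l i" "psize m = psize l"
  shows "m = l"
proof -
  obtain n where n: "\<And>i. n \<le> i \<Longrightarrow> l i = 0" using assms(2) partitions_eventually_zero by blast
  then have n': "\<And>i. n \<le> i \<Longrightarrow> m i = 0" using assms(3) by (metis le_zero_eq)
  have eq: "(\<Sum>i<n. m i) = (\<Sum>i<n. l i)" using assms(4) n n' by (simp only: psize_eq_sum_lessThan[of n])
  have "m i = l i" for i
  proof (cases "i < n")
    case True
    show ?thesis
    proof (rule ccontr)
      assume "m i \<noteq> l i"
      then have "m i < l i" using assms(3)[of i] by simp
      then have "(\<Sum>i<n. m i) < (\<Sum>i<n. l i)"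
        using True assms(3) by (intro sum_strict_mono_ex1) auto
      then show False using eq by simp
    qed
  qed (simp add: n n')
  then show ?thesis by blast
qed

lemma interlaces_psize: "m \<prec> l \<Longrightarrow> m \<in> partitions \<Longrightarrow> l \<in> partitions \<Longrightarrow> psize m \<le> psize l"
  by (intro psize_mono) (auto simp: interlaces_def)

section \<open>The local growth rule\<close>

text \<open>The piecewise linear form of the local rule in growth diagrams: \<open>k i\<close> is
  reflected in the interval from \<open>max (m (Suc i)) (n (Suc i))\<close> to
  \<open>min (m i) (n i)\<close> and becomes part \<open>Suc i\<close> of the new partition. Part 0
  has no upper bound and absorbs \<open>G\<close>.\<close>

definition growth :: "(nat \<Rightarrow> nat) \<Rightarrow> (nat \<Rightarrow> nat) \<Rightarrow> nat \<Rightarrow> (nat \<Rightarrow> nat) \<Rightarrow> nat \<Rightarrow> nat" where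
  "growth m n G k i =
     (case i of 0 \<Rightarrow> max (m 0) (n 0) + G
      | Suc i \<Rightarrow> max (m (Suc i)) (n (Suc i)) + min (m i) (n i) - k i)"

definition growth_inv :: "(nat \<Rightarrow> nat) \<Rightarrow> (nat \<Rightarrow> nat) \<Rightarrow> (nat \<Rightarrow> nat) \<Rightarrow> nat \<Rightarrow> nat" where
  "growth_inv m n l i = max (m (Suc i)) (n (Suc i)) + min (m i) (n i) - l (Suc i)"

lemma growth_0 [simp]: "growth m n G k 0 = max (m 0) (n 0) + G"
  by (simp add: growth_def)

lemma growth_Suc: "growth m n G k (Suc i) = max (m (Suc i)) (n (Suc i)) + min (m i) (n i) - k i"
  by (simp add: growth_def)

text \<open>Reflection of an interval is an involution. With truncated subtraction this needs the
  two bounds, which interlacing supplies.\<close>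

lemma nat_reflect:
  fixes x M n :: nat
  assumes "M \<le> x" "x \<le> n"
  shows "M \<le> M + n - x" "M + n - x \<le> n" "M + n - (M + n - x) = x" "M + n - x + x = M + n"
  using assms by auto

text \<open>Valley and peak conditions confine the entries to the same intervals up to an index
  shift, so the reflection carries one kind into the other.\<close>

lemma interlaces_both_iff:
  "k \<prec> m \<and> k \<prec> n \<longleftrightarrow> (\<forall>i. max (m (Suc i)) (n (Suc i)) \<le> k i \<and> k i \<le> min (m i) (n i))"
  unfolding interlaces_def max.bounded_iff min.bounded_iff by blast

lemma both_interlace_iff:
  "m \<prec> l \<and> n \<prec> l \<longleftrightarrow> (\<forall>i. max (m i) (n i) \<le> l i \<and> l (Suc i) \<le> min (m i) (n i))"
  unfolding interlaces_def max.bounded_iff min.bounded_iff by blast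

lemma growth_interlaces:
  assumes "m \<in> partitions" "n \<in> partitions" "k \<prec> m" "k \<prec> n"
  shows "m \<prec> growth m n G k" "n \<prec> growth m n G k" "growth m n G k \<in> partitions"
proof -
  have b: "max (m (Suc i)) (n (Suc i)) \<le> k i" "k i \<le> min (m i) (n i)" for i
    using assms(3,4) interlaces_both_iff[of k m n] by blast+
  have d: "growth m n G k (Suc i) \<le> min (m i) (n i)" for i
    unfolding growth_Suc by (rule nat_reflect(2)[OF b])
  have c: "max (m i) (n i) \<le> growth m n G k i" for i
    by (cases i) (simp, simp only: growth_Suc nat_reflect(1)[OF b])
  show "m \<prec> growth m n G k" "n \<prec> growth m n G k"
    using c d both_interlace_iff[of m "growth m n G k" n] by blast+
  obtain r where r: "\<And>i. r \<le> i \<Longrightarrow> m i = 0" using assms(1) partitions_eventually_zero by blast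
  show "growth m n G k \<in> partitions"
  proof (rule partitionsI[of _ "Suc r"])
    fix i
    have "min (m i) (n i) \<le> max (m i) (n i)" by simp
    then show "growth m n G k (Suc i) \<le> growth m n G k i"
      using d[of i] c[of i] by (meson order.trans)
  next
    fix i assume "Suc r \<le> i"
    then obtain j where "i = Suc j" "r \<le> j" by (cases i) auto
    then show "growth m n G k i = 0" using d[of j] r[of j] by simp
  qed
qed

lemma growth_inv_interlaces:
  assumes "m \<in> partitions" "m \<prec> l" "n \<prec> l"
  shows "growth_inv m n l \<prec> m" "growth_inv m n l \<prec> n" "growth_inv m n l \<in> partitions"
proof -
  have b: "max (m (Suc i)) (n (Suc i)) \<le> l (Suc i)" "l (Suc i) \<le> min (m i) (n i)" for i
    using assms(2,3) both_interlace_iff[of m l n] by blast+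
  have c: "max (m (Suc i)) (n (Suc i)) \<le> growth_inv m n l i"
    "growth_inv m n l i \<le> min (m i) (n i)" for i
    unfolding growth_inv_def by (rule nat_reflect(1,2)[OF b])+
  show "growth_inv m n l \<prec> m" "growth_inv m n l \<prec> n"
    using c interlaces_both_iff[of "growth_inv m n l" m n] by blast+
  obtain r where r: "\<And>i. r \<le> i \<Longrightarrow> m i = 0" using assms(1) partitions_eventually_zero by blast
  show "growth_inv m n l \<in> partitions"
  proof (rule partitionsI[of _ r])
    fix i
    have "min (m (Suc i)) (n (Suc i)) \<le> max (m (Suc i)) (n (Suc i))" by simp
    then show "growth_inv m n l (Suc i) \<le> growth_inv m n l i"
      using c(1)[of i] c(2)[of "Suc i"] by (meson order.trans)
  next
    fix i assume "r \<le> i"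
    then show "growth_inv m n l i = 0" using c(2)[of i] r[of i] by simp
  qed
qed

lemma growth_inv_growth:
  assumes "k \<prec> m" "k \<prec> n"
  shows "growth_inv m n (growth m n G k) = k"
proof
  fix i
  have "max (m (Suc i)) (n (Suc i)) \<le> k i" "k i \<le> min (m i) (n i)"
    using assms interlaces_both_iff[of k m n] by blast+
  then show "growth_inv m n (growth m n G k) i = k i"
    unfolding growth_inv_def growth_Suc by (rule nat_reflect(3))
qed

lemma growth_growth_inv:
  assumes "m \<prec> l" "n \<prec> l"
  shows "growth m n (l 0 - max (m 0) (n 0)) (growth_inv m n l) = l"
proof
  fix i
  have b: "max (m i) (n i) \<le> l i" "l (Suc i) \<le> min (m i) (n i)" for i
    using assms both_interlace_iff[of m l n] by blast+
  show "growth m n (l 0 - max (m 0) (n 0)) (growth_inv m n l) i = l i"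
  proof (cases i)
    case 0
    then show ?thesis using b(1)[of 0] by simp
  next
    case (Suc j)
    show ?thesis unfolding Suc growth_Suc growth_inv_def by (rule nat_reflect(3)[OF b])
  qed
qed

text \<open>A reflected pair sums to maximum plus minimum. Pairing part \<open>Suc i\<close> of the
  new partition with \<open>k i\<close> therefore reduces the claim to
  \<open>max + min = m + n\<close>, and the unpaired part 0 contributes \<open>G\<close>.\<close>

lemma psize_growth:
  assumes "m \<in> partitions" "n \<in> partitions" "k \<prec> m" "k \<prec> n"
  shows "psize (growth m n G k) + psize k = psize m + psize n + G"
proof -
  obtain r where r: "\<And>i. r \<le> i \<Longrightarrow> m i = 0" using assms(1) partitions_eventually_zero by blast
  obtain s where s: "\<And>i. s \<le> i \<Longrightarrow> n i = 0" using assms(2) partitions_eventually_zero by blast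
  define t where "t = max r s"
  have b: "max (m (Suc i)) (n (Suc i)) \<le> k i" "k i \<le> min (m i) (n i)" for i
    using assms(3,4) interlaces_both_iff[of k m n] by blast+
  have mt: "m i = 0" if "t \<le> i" for i
    using that r by (simp add: t_def)
  have nt: "n i = 0" if "t \<le> i" for i
    using that s by (simp add: t_def)
  have kt: "k i = 0" if "t \<le> i" for i
    using b(2)[of i] mt[OF that] by simp
  \<comment> \<open>The new partition may have one part more than its neighbours.\<close>
  have gt: "growth m n G k i = 0" if "Suc t \<le> i" for i
  proof -
    obtain j where j: "i = Suc j" "t \<le> j" using \<open>Suc t \<le> i\<close> Suc_le_D by blast
    then show ?thesis by (simp add: growth_Suc mt nt)
  qed
  have "psize (growth m n G k) + psize k = (\<Sum>i<Suc t. growth m n G k i) + (\<Sum>i<t. k i)"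
    by (simp only: psize_eq_sum_lessThan[of "Suc t", OF gt] psize_eq_sum_lessThan[of t, OF kt])
  also have "\<dots> = max (m 0) (n 0) + G + (\<Sum>i<t. growth m n G k (Suc i) + k i)"
    by (simp only: sum.lessThan_Suc_shift growth_0 sum.distrib add.assoc)
  also have "(\<Sum>i<t. growth m n G k (Suc i) + k i)
      = (\<Sum>i<t. max (m (Suc i)) (n (Suc i)) + min (m i) (n i))"
    by (intro sum.cong refl) (simp only: growth_Suc nat_reflect(4)[OF b])
  also have "\<dots> = (\<Sum>i<t. max (m (Suc i)) (n (Suc i))) + (\<Sum>i<t. min (m i) (n i))"
    by (rule sum.distrib)
  also have "max (m 0) (n 0) + G + \<dots> = (\<Sum>i<Suc t. max (m i) (n i)) + (\<Sum>i<t. min (m i) (n i)) + G"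
    by (simp only: sum.lessThan_Suc_shift add_ac)
  also have "(\<Sum>i<Suc t. max (m i) (n i)) = (\<Sum>i<t. max (m i) (n i))"
    using mt nt by simp
  also have "\<dots> + (\<Sum>i<t. min (m i) (n i)) = (\<Sum>i<t. m i + n i)"
    unfolding sum.distrib[symmetric] by (intro sum.cong) auto
  also have "\<dots> = psize m + psize n"
    by (simp only: psize_eq_sum_lessThan[of t, OF mt] psize_eq_sum_lessThan[of t, OF nt] sum.distrib)
  finally show ?thesis .
qed

section \<open>Configurations on the cycle\<close>

definition cyc :: "nat \<Rightarrow> int set" where
  "cyc N = {0..<2 * int N}"

definition lt :: "nat \<Rightarrow> int \<Rightarrow> int" where
  "lt N h = (h - 1) mod (2 * int N)"

definition rt :: "nat \<Rightarrow> int \<Rightarrow> int" where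
  "rt N h = (h + 1) mod (2 * int N)"

text \<open>\<open>D\<close> is the set of positions from which the profile steps up when moving to the right.\<close>

definition configs :: "nat \<Rightarrow> int set \<Rightarrow> (int \<Rightarrow> nat \<Rightarrow> nat) set" where
  "configs N D = {\<Lambda> \<in> cyc N \<rightarrow>\<^sub>E partitions.
     \<forall>h\<in>cyc N. if h \<in> D then \<Lambda> h \<prec> \<Lambda> (rt N h) else \<Lambda> (rt N h) \<prec> \<Lambda> h}"

definition weight :: "nat \<Rightarrow> (int \<Rightarrow> real) \<Rightarrow> (int \<Rightarrow> nat \<Rightarrow> nat) \<Rightarrow> real" where
  "weight N c \<Lambda> = (\<Prod>h\<in>cyc N. c h ^ psize (\<Lambda> h))"

lemma finite_cyc [simp]: "finite (cyc N)"
  by (simp add: cyc_def)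

lemma cyc_nbr [simp]: "1 \<le> N \<Longrightarrow> lt N h \<in> cyc N" "1 \<le> N \<Longrightarrow> rt N h \<in> cyc N"
  by (simp_all add: cyc_def lt_def rt_def)

lemma cyc_mod: "h \<in> cyc N \<Longrightarrow> h mod (2 * int N) = h"
  by (simp add: cyc_def)

lemma rt_lt [simp]: "h \<in> cyc N \<Longrightarrow> rt N (lt N h) = h"
  by (simp add: lt_def rt_def mod_simps cyc_mod)

lemma lt_rt [simp]: "h \<in> cyc N \<Longrightarrow> lt N (rt N h) = h"
  by (simp add: lt_def rt_def mod_simps cyc_mod)

text \<open>The circumference is even, so parity survives the reduction and alternates along the
  cycle.\<close>

lemma even_mod_cyc: "even (h mod (2 * int N)) = even h"
  by (simp add: even_even_mod_4_iff dvd_mod_iff)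

lemma even_lt [simp]: "even (lt N h) \<longleftrightarrow> odd h"
  and even_rt [simp]: "even (rt N h) \<longleftrightarrow> odd h"
  by (simp_all add: lt_def rt_def even_mod_cyc)

lemma nbr_neq [simp]: "lt N h \<noteq> h" "rt N h \<noteq> h"
  by (metis even_lt) (metis even_rt)

lemmas nbr_neq' [simp] = nbr_neq[symmetric]

lemma countable_configs: "countable (configs N D)"
proof (rule countable_subset)
  show "configs N D \<subseteq> cyc N \<rightarrow>\<^sub>E partitions" by (auto simp: configs_def)
  show "countable (cyc N \<rightarrow>\<^sub>E partitions)"
    by (intro countable_PiE) (auto simp: countable_partitions)
qed

lemma configs_partition: "\<Lambda> \<in> configs N D \<Longrightarrow> h \<in> cyc N \<Longrightarrow> \<Lambda> h \<in> partitions"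
  by (auto simp: configs_def)

text \<open>Isolates the two steps that meet at \<open>h\<close>; the remaining conditions do not
  mention the value at \<open>h\<close>.\<close>

lemma configs_peak_iff:
  assumes "1 \<le> N" "h \<in> cyc N" "lt N h \<in> D" "h \<notin> D"
  shows "\<Lambda> \<in> configs N D \<longleftrightarrow> \<Lambda> \<in> cyc N \<rightarrow>\<^sub>E partitions \<and>
     \<Lambda> (lt N h) \<prec> \<Lambda> h \<and> \<Lambda> (rt N h) \<prec> \<Lambda> h \<and>
     (\<forall>k\<in>cyc N - {h, lt N h}. if k \<in> D then \<Lambda> k \<prec> \<Lambda> (rt N k) else \<Lambda> (rt N k) \<prec> \<Lambda> k)"
proof -
  have "cyc N = insert h (insert (lt N h) (cyc N - {h, lt N h}))" using assms by auto
  then have "(\<forall>k\<in>cyc N. P k) \<longleftrightarrow> P h \<and> P (lt N h) \<and> (\<forall>k\<in>cyc N - {h, lt N h}. P k)" for P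
    by (metis insert_iff)
  then show ?thesis using assms(2-) by (auto simp: configs_def)
qed

lemma configs_valley_iff:
  assumes "1 \<le> N" "h \<in> cyc N" "lt N h \<notin> D" "h \<in> D"
  shows "\<Lambda> \<in> configs N D \<longleftrightarrow> \<Lambda> \<in> cyc N \<rightarrow>\<^sub>E partitions \<and>
     \<Lambda> h \<prec> \<Lambda> (lt N h) \<and> \<Lambda> h \<prec> \<Lambda> (rt N h) \<and>
     (\<forall>k\<in>cyc N - {h, lt N h}. if k \<in> D then \<Lambda> k \<prec> \<Lambda> (rt N k) else \<Lambda> (rt N k) \<prec> \<Lambda> k)"
proof -
  have "cyc N = insert h (insert (lt N h) (cyc N - {h, lt N h}))" using assms by auto
  then have "(\<forall>k\<in>cyc N. P k) \<longleftrightarrow> P h \<and> P (lt N h) \<and> (\<forall>k\<in>cyc N - {h, lt N h}. P k)" for P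
    by (metis insert_iff)
  then show ?thesis using assms(2-) by (auto simp: configs_def)
qed

text \<open>The growth rule acts at the single position \<open>h\<close> and flips the two steps
  meeting there, which is the passage from \<open>D\<close> to \<open>D'\<close>; \<open>G\<close>
  together with the valley entry holds the information of the peak entry. The two neighbours may
  coincide, as they do for \<open>N = 1\<close>.\<close>

lemma bij_betw_growth:
  assumes N: "1 \<le> N" and h: "h \<in> cyc N" "lt N h \<in> D" "h \<notin> D"
    and D': "D' = insert h (D - {lt N h})"
  shows "bij_betw (\<lambda>(G, \<Lambda>). \<Lambda>(h := growth (\<Lambda> (lt N h)) (\<Lambda> (rt N h)) G (\<Lambda> h)))
     (UNIV \<times> configs N D') (configs N D)"
proof -
  let ?R = "\<lambda>\<Lambda>. \<forall>k\<in>cyc N - {h, lt N h}. if k \<in> D then \<Lambda> k \<prec> \<Lambda> (rt N k) else \<Lambda> (rt N k) \<prec> \<Lambda> k"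
  let ?R' = "\<lambda>\<Lambda>. \<forall>k\<in>cyc N - {h, lt N h}. if k \<in> D' then \<Lambda> k \<prec> \<Lambda> (rt N k) else \<Lambda> (rt N k) \<prec> \<Lambda> k"
  have RR': "?R' \<Lambda> \<longleftrightarrow> ?R \<Lambda>" for \<Lambda> unfolding D' by auto
  have Rupd: "?R (\<Lambda>(h := x)) \<longleftrightarrow> ?R \<Lambda>" for \<Lambda> x
  proof -
    have "k \<noteq> h \<and> rt N k \<noteq> h" if "k \<in> cyc N - {h, lt N h}" for k
      using that by (metis DiffE insertCI lt_rt)
    then show ?thesis by (intro ball_cong refl) auto
  qed
  have peak: "\<Lambda> \<in> configs N D \<longleftrightarrow> \<Lambda> \<in> cyc N \<rightarrow>\<^sub>E partitions \<and>
     \<Lambda> (lt N h) \<prec> \<Lambda> h \<and> \<Lambda> (rt N h) \<prec> \<Lambda> h \<and> ?R \<Lambda>" for \<Lambda>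
    by (rule configs_peak_iff[OF N h])
  have valley: "\<Lambda> \<in> configs N D' \<longleftrightarrow> \<Lambda> \<in> cyc N \<rightarrow>\<^sub>E partitions \<and>
     \<Lambda> h \<prec> \<Lambda> (lt N h) \<and> \<Lambda> h \<prec> \<Lambda> (rt N h) \<and> ?R \<Lambda>" for \<Lambda>
    unfolding RR'[symmetric] by (rule configs_valley_iff[OF N h(1)]) (simp_all add: D')
  have upd: "\<Lambda>(h := x) \<in> cyc N \<rightarrow>\<^sub>E partitions"
    if "\<Lambda> \<in> cyc N \<rightarrow>\<^sub>E partitions" "x \<in> partitions" for \<Lambda> and x :: "nat \<Rightarrow> nat"
    using that h(1) by (auto simp: PiE_iff extensional_def)
  show ?thesis
  proof (rule bij_betw_byWitness[where f' = "\<lambda>\<Lambda>.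
      (\<Lambda> h 0 - max (\<Lambda> (lt N h) 0) (\<Lambda> (rt N h) 0),
       \<Lambda>(h := growth_inv (\<Lambda> (lt N h)) (\<Lambda> (rt N h)) (\<Lambda> h)))"])
    show "\<forall>x\<in>UNIV \<times> configs N D'.
       (\<lambda>\<Lambda>. (\<Lambda> h 0 - max (\<Lambda> (lt N h) 0) (\<Lambda> (rt N h) 0),
          \<Lambda>(h := growth_inv (\<Lambda> (lt N h)) (\<Lambda> (rt N h)) (\<Lambda> h))))
        ((\<lambda>(G, \<Lambda>). \<Lambda>(h := growth (\<Lambda> (lt N h)) (\<Lambda> (rt N h)) G (\<Lambda> h))) x) = x"
      by (clarsimp simp: valley growth_inv_growth)
    show "\<forall>\<Lambda>\<in>configs N D.
       (\<lambda>(G, \<Lambda>). \<Lambda>(h := growth (\<Lambda> (lt N h)) (\<Lambda> (rt N h)) G (\<Lambda> h)))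
        (\<Lambda> h 0 - max (\<Lambda> (lt N h) 0) (\<Lambda> (rt N h) 0),
          \<Lambda>(h := growth_inv (\<Lambda> (lt N h)) (\<Lambda> (rt N h)) (\<Lambda> h))) = \<Lambda>"
      by (clarsimp simp: peak growth_growth_inv)
    show "(\<lambda>(G, \<Lambda>). \<Lambda>(h := growth (\<Lambda> (lt N h)) (\<Lambda> (rt N h)) G (\<Lambda> h))) ` (UNIV \<times> configs N D')
        \<subseteq> configs N D"
    proof clarify
      fix G \<Lambda> assume L: "\<Lambda> \<in> configs N D'"
      have p: "\<Lambda> (lt N h) \<in> partitions" "\<Lambda> (rt N h) \<in> partitions"
        using configs_partition[OF L] N by auto
      have v: "\<Lambda> \<in> cyc N \<rightarrow>\<^sub>E partitions" "\<Lambda> h \<prec> \<Lambda> (lt N h)" "\<Lambda> h \<prec> \<Lambda> (rt N h)" "?R \<Lambda>"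
        using L unfolding valley by blast+
      note g = growth_interlaces[OF p v(2,3)]
      show "\<Lambda>(h := growth (\<Lambda> (lt N h)) (\<Lambda> (rt N h)) G (\<Lambda> h)) \<in> configs N D"
        unfolding peak Rupd
        by (intro conjI upd v(1,4) g(3)) (simp_all add: g(1,2))
    qed
    show "(\<lambda>\<Lambda>. (\<Lambda> h 0 - max (\<Lambda> (lt N h) 0) (\<Lambda> (rt N h) 0),
          \<Lambda>(h := growth_inv (\<Lambda> (lt N h)) (\<Lambda> (rt N h)) (\<Lambda> h)))) ` configs N D
        \<subseteq> UNIV \<times> configs N D'"
    proof (rule image_subsetI)
      fix \<Lambda> assume L: "\<Lambda> \<in> configs N D"
      have p: "\<Lambda> (lt N h) \<in> partitions"
        using configs_partition[OF L] N by auto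
      have v: "\<Lambda> \<in> cyc N \<rightarrow>\<^sub>E partitions" "\<Lambda> (lt N h) \<prec> \<Lambda> h" "\<Lambda> (rt N h) \<prec> \<Lambda> h" "?R \<Lambda>"
        using L unfolding peak by blast+
      note g = growth_inv_interlaces[OF p v(2,3)]
      have "\<Lambda>(h := growth_inv (\<Lambda> (lt N h)) (\<Lambda> (rt N h)) (\<Lambda> h)) \<in> configs N D'"
        unfolding valley Rupd
        by (intro conjI upd v(1,4) g(3)) (simp_all add: g(1,2))
      then show "(\<Lambda> h 0 - max (\<Lambda> (lt N h) 0) (\<Lambda> (rt N h) 0),
          \<Lambda>(h := growth_inv (\<Lambda> (lt N h)) (\<Lambda> (rt N h)) (\<Lambda> h))) \<in> UNIV \<times> configs N D'"
        by simp
    qed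
  qed
qed

text \<open>
  The growth rule conserves sizes up to the new entry: top and bottom together have the size of left
  and right plus \<open>G\<close>. So a removed peak hands its weight to both neighbours, which coincide if \<open>N = 1\<close>.
\<close>

definition removal_weights :: "nat \<Rightarrow> int \<Rightarrow> (int \<Rightarrow> real) \<Rightarrow> int \<Rightarrow> real" where
  "removal_weights N h c k =
     (if k = h then inverse (c h)
      else c k * (if k = lt N h then c h else 1) * (if k = rt N h then c h else 1))"

lemma weight_growth:
  assumes N: "1 \<le> N" and h: "h \<in> cyc N" "c h > 0"
    and L: "\<And>k. k \<in> cyc N \<Longrightarrow> \<Lambda> k \<in> partitions" "\<Lambda> h \<prec> \<Lambda> (lt N h)" "\<Lambda> h \<prec> \<Lambda> (rt N h)"
  shows "weight N c (\<Lambda>(h := growth (\<Lambda> (lt N h)) (\<Lambda> (rt N h)) G (\<Lambda> h)))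
     = c h ^ G * weight N (removal_weights N h c) \<Lambda>"
proof -
  let ?c' = "removal_weights N h c" and ?C = "cyc N - {h}"
  let ?top = "growth (\<Lambda> (lt N h)) (\<Lambda> (rt N h)) G (\<Lambda> h)"
  have size: "psize ?top + psize (\<Lambda> h) = psize (\<Lambda> (lt N h)) + psize (\<Lambda> (rt N h)) + G"
    using L N by (intro psize_growth) auto
  have split: "weight N d F = d h ^ psize (F h) * (\<Prod>k\<in>?C. d k ^ psize (F k))" for d F
    unfolding weight_def by (rule prod.remove) (use h in auto)
  have delta: "(\<Prod>k\<in>?C. (if k = j then c h else 1) ^ psize (\<Lambda> k)) = c h ^ psize (\<Lambda> j)"
    if "j \<in> ?C" for j
  proof -
    have "(\<Prod>k\<in>?C. (if k = j then c h else 1) ^ psize (\<Lambda> k))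
        = (\<Prod>k\<in>?C. if k = j then c h ^ psize (\<Lambda> k) else 1)"
      by (intro prod.cong) auto
    then show ?thesis using that by (simp add: prod.delta)
  qed
  have "(\<Prod>k\<in>?C. ?c' k ^ psize (\<Lambda> k))
      = (\<Prod>k\<in>?C. c k ^ psize (\<Lambda> k) * (if k = lt N h then c h else 1) ^ psize (\<Lambda> k)
                * (if k = rt N h then c h else 1) ^ psize (\<Lambda> k))"
    by (intro prod.cong refl) (simp add: removal_weights_def power_mult_distrib)
  also have "\<dots> = (\<Prod>k\<in>?C. c k ^ psize (\<Lambda> k)) * c h ^ psize (\<Lambda> (lt N h)) * c h ^ psize (\<Lambda> (rt N h))"
    using N by (simp add: prod.distrib delta)
  finally have *: "(\<Prod>k\<in>?C. ?c' k ^ psize (\<Lambda> k)) = \<dots>" .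
  have "c h ^ psize ?top * c h ^ psize (\<Lambda> h) =
      c h ^ psize (\<Lambda> (lt N h)) * c h ^ psize (\<Lambda> (rt N h)) * c h ^ G"
    by (simp only: power_add[symmetric] size)
  then have "c h ^ psize ?top = c h ^ psize (\<Lambda> (lt N h)) * c h ^ psize (\<Lambda> (rt N h)) * c h ^ G
      * inverse (c h) ^ psize (\<Lambda> h)"
    using h(2) by (simp add: field_simps)
  moreover have "(\<Prod>k\<in>?C. c k ^ psize ((\<Lambda>(h := ?top)) k)) = (\<Prod>k\<in>?C. c k ^ psize (\<Lambda> k))"
    by (intro prod.cong) auto
  ultimately show ?thesis
    unfolding split * by (simp add: removal_weights_def)
qed

lemma nn_integral_count_space_prod:
  assumes "countable A" "countable B"
  shows "(\<integral>\<^sup>+x. f x \<partial>count_space (A \<times> B)) =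
    (\<integral>\<^sup>+a. \<integral>\<^sup>+b. f (a, b) \<partial>count_space B \<partial>count_space A)"
proof -
  interpret sigma_finite_measure "count_space B"
    using assms(2) by (rule sigma_finite_measure_count_space_countable)
  show ?thesis
    using nn_integral_fst[of f "count_space A"] assms by (simp add: pair_measure_countable)
qed

text \<open>Transports a weighted sum along \<open>bij_betw_growth\<close>. The sum over
  \<open>G\<close> is kept innermost because it will be matched with the expectation over one
  geometric weight.\<close>

lemma nn_integral_peak_removal:
  fixes f :: "(int \<Rightarrow> nat \<Rightarrow> nat) \<Rightarrow> ennreal"
  assumes N: "1 \<le> N" and h: "h \<in> cyc N" "lt N h \<in> D" "h \<notin> D" and c: "c h > 0"
  shows "(\<integral>\<^sup>+\<Lambda>. ennreal (weight N c \<Lambda>) * f \<Lambda> \<partial>count_space (configs N D)) =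
    (\<integral>\<^sup>+\<Lambda>. ennreal (weight N (removal_weights N h c) \<Lambda>) *
       (\<integral>\<^sup>+G. ennreal (c h ^ G) * f (\<Lambda>(h := growth (\<Lambda> (lt N h)) (\<Lambda> (rt N h)) G (\<Lambda> h)))
          \<partial>count_space UNIV)
     \<partial>count_space (configs N (insert h (D - {lt N h}))))"
    (is "?lhs = (\<integral>\<^sup>+\<Lambda>. ?W' \<Lambda> * _ \<partial>count_space ?C')")
proof -
  let ?top = "\<lambda>\<Lambda> G. \<Lambda>(h := growth (\<Lambda> (lt N h)) (\<Lambda> (rt N h)) G (\<Lambda> h))"
  have W: "ennreal (weight N c (?top \<Lambda> G)) = ?W' \<Lambda> * ennreal (c h ^ G)" if "\<Lambda> \<in> ?C'" for \<Lambda> G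
  proof -
    have "\<Lambda> h \<prec> \<Lambda> (lt N h)" "\<Lambda> h \<prec> \<Lambda> (rt N h)"
      using that configs_valley_iff[OF N h(1), of "insert h (D - {lt N h})" \<Lambda>] by auto
    then have "weight N c (?top \<Lambda> G) = c h ^ G * weight N (removal_weights N h c) \<Lambda>"
      using that c by (intro weight_growth[OF N h(1)]) (auto intro: configs_partition)
    then show ?thesis using c by (simp add: ennreal_mult'[symmetric] mult.commute ennreal_mult'')
  qed
  have "?lhs = (\<integral>\<^sup>+x. (case x of (G, \<Lambda>) \<Rightarrow> ennreal (weight N c (?top \<Lambda> G)) * f (?top \<Lambda> G))
      \<partial>count_space (UNIV \<times> ?C'))"
    by (subst nn_integral_bij_count_space[OF bij_betw_growth[OF N h refl], symmetric])
       (simp add: case_prod_unfold)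
  also have "\<dots> = (\<integral>\<^sup>+x. (\<lambda>(\<Lambda>, G). ennreal (weight N c (?top \<Lambda> G)) * f (?top \<Lambda> G)) x
      \<partial>count_space (?C' \<times> UNIV))"
  proof -
    have "bij_betw prod.swap (?C' \<times> (UNIV::nat set)) (UNIV \<times> ?C')"
      by (intro bij_betw_byWitness[where f' = prod.swap]) auto
    then show ?thesis
      by (subst nn_integral_bij_count_space[symmetric]) (auto simp: case_prod_unfold)
  qed
  also have "\<dots> = (\<integral>\<^sup>+\<Lambda>. (\<integral>\<^sup>+G. ennreal (weight N c (?top \<Lambda> G)) * f (?top \<Lambda> G) \<partial>count_space UNIV)
      \<partial>count_space ?C')"
    by (subst nn_integral_count_space_prod) (auto simp: countable_configs)
  also have "\<dots> = (\<integral>\<^sup>+\<Lambda>. ?W' \<Lambda> * (\<integral>\<^sup>+G. ennreal (c h ^ G) * f (?top \<Lambda> G) \<partial>count_space UNIV)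
      \<partial>count_space ?C')"
    by (intro nn_integral_cong) (auto simp: W mult.assoc nn_integral_cmult)
  finally show ?thesis .
qed

section \<open>Profiles\<close>

text \<open>Distance from the top square along the cycle. As a time function it is the profile of a
  cylindric plane partition.\<close>

definition pos :: "nat \<Rightarrow> int \<Rightarrow> int" where
  "pos N h = min h (2 * int N - h)"

lemma lt_eq: "h \<in> cyc N \<Longrightarrow> lt N h = (if h = 0 then 2 * int N - 1 else h - 1)"
  by (auto simp: lt_def cyc_def zmod_minus1)

lemma rt_eq: "h \<in> cyc N \<Longrightarrow> rt N h = (if h = 2 * int N - 1 then 0 else h + 1)"
  by (auto simp: rt_def cyc_def)

lemma pos_nbr:
  assumes "h \<in> cyc N"
  shows "\<bar>pos N (lt N h) - pos N h\<bar> = 1" "\<bar>pos N (rt N h) - pos N h\<bar> = 1"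
proof -
  show "\<bar>pos N (lt N h) - pos N h\<bar> = 1"
    unfolding lt_eq[OF assms] using assms by (auto simp: pos_def cyc_def min_def)
  show "\<bar>pos N (rt N h) - pos N h\<bar> = 1"
    unfolding rt_eq[OF assms] using assms by (auto simp: pos_def cyc_def min_def)
qed

lemma pos_bounds: "h \<in> cyc N \<Longrightarrow> 0 \<le> pos N h" "pos N h \<le> int N"
  by (auto simp: pos_def cyc_def)

lemma even_pos [simp]: "even (pos N h) \<longleftrightarrow> even h"
  by (auto simp: pos_def min_def)

text \<open>Wrapping turns the interval centred at 0 into a ball for \<open>pos\<close>. From
  \<open>n = N\<close> on the distance condition is void, which merges the two cases of
  \<open>slice\<close>.\<close>

lemma slice_Suc:
  assumes "1 \<le> N"
  shows "slice N (Suc n) = {h \<in> cyc N. even (h + int n) \<and> pos N h \<le> int n}"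
proof -
  have par: "[h = int (Suc n) - 1] (mod 2) \<longleftrightarrow> even (h + int n)" for h
    by (simp add: cong_iff_dvd_diff)
  show ?thesis
  proof (cases "Suc n \<le> N")
    case True
    have "(\<lambda>h. h mod (2 * int N)) ` {h. - int n \<le> h \<and> h \<le> int n \<and> even (h + int n)} =
        {h \<in> cyc N. even (h + int n) \<and> pos N h \<le> int n}" (is "?f ` ?A = ?B")
    proof
      show "?f ` ?A \<subseteq> ?B"
      proof (rule image_subsetI)
        fix h assume h: "h \<in> ?A"
        have "?f h = (if 0 \<le> h then h else h + 2 * int N)"
        proof (cases "0 \<le> h")
          case False
          have "?f h = (h + 2 * int N) mod (2 * int N)" by simp
          also have "\<dots> = h + 2 * int N" using False h True by (intro mod_pos_pos_trivial) auto
          finally show ?thesis using False by simp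
        qed (use h True in auto)
        then show "?f h \<in> ?B" using h True by (auto simp: cyc_def pos_def)
      qed
      show "?B \<subseteq> ?f ` ?A"
      proof
        fix x assume x: "x \<in> ?B"
        show "x \<in> ?f ` ?A"
        proof (cases "x \<le> int n")
          case True
          then show ?thesis using x by (intro image_eqI[of _ _ x]) (auto simp: cyc_def)
        next
          case False
          then show ?thesis using x
            by (intro image_eqI[of _ _ "x - 2 * int N"]) (auto simp: cyc_def pos_def)
        qed
      qed
    qed
    then show ?thesis using True unfolding slice_def par by simp
  next
    case False
    then have "pos N h \<le> int n" for h using pos_bounds(2)[of N h] by simp
    then show ?thesis using False unfolding slice_def par by (auto simp: cyc_def)
  qed
qed

lemma slice_subset_cyc: "1 \<le> N \<Longrightarrow> 1 \<le> k \<Longrightarrow> slice N k \<subseteq> cyc N"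
  using slice_Suc[of N "k - 1"] by auto

lemma finite_slice: "1 \<le> N \<Longrightarrow> 1 \<le> k \<Longrightarrow> finite (slice N k)"
  using slice_subset_cyc finite_cyc finite_subset by metis

text \<open>These sizes become the exponents \<open>min k N\<close> in the product that converges to
  the normalizing constant.\<close>

lemma card_slice:
  assumes "1 \<le> N"
  shows "card (slice N (Suc n)) = min (Suc n) N"
proof (cases "Suc n \<le> N")
  case True
  have "bij_betw (\<lambda>i. (int n - 2 * int i) mod (2 * int N)) {..n} (slice N (Suc n))"
  proof (rule bij_betw_imageI)
    show "inj_on (\<lambda>i. (int n - 2 * int i) mod (2 * int N)) {..n}"
    proof (rule inj_onI)
      fix i j assume ij: "i \<in> {..n}" "j \<in> {..n}"
        and "(int n - 2 * int i) mod (2 * int N) = (int n - 2 * int j) mod (2 * int N)"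
      then have "2 * int N dvd 2 * (int j - int i)"
        by (simp add: mod_eq_dvd_iff algebra_simps)
      \<comment> \<open>Both indices are at most \<open>n < N\<close>, so a multiple of
        \<open>N\<close> as difference forces equality.\<close>
      then have "int N dvd int j - int i" by (metis dvd_mult_cancel_left zero_neq_numeral)
      moreover have "\<bar>int j - int i\<bar> < int N" using ij True by auto
      ultimately have "int j - int i = 0" using zdvd_imp_le zdvd_not_zless
        by (metis abs_dvd_iff dvd_abs_iff zero_less_abs_iff)
      then show "i = j" by simp
    qed
    have eq: "(\<lambda>i. int n - 2 * int i) ` {..n} = {h. - int n \<le> h \<and> h \<le> int n \<and> [h = int n] (mod 2)}"
    proof
      show "(\<lambda>i. int n - 2 * int i) ` {..n} \<subseteq> {h. - int n \<le> h \<and> h \<le> int n \<and> [h = int n] (mod 2)}"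
        by (auto simp: cong_iff_dvd_diff)
      show "{h. - int n \<le> h \<and> h \<le> int n \<and> [h = int n] (mod 2)} \<subseteq> (\<lambda>i. int n - 2 * int i) ` {..n}"
      proof
        fix h assume h: "h \<in> {h. - int n \<le> h \<and> h \<le> int n \<and> [h = int n] (mod 2)}"
        then have "even (int n - h)" by (simp add: cong_iff_dvd_diff)
        then obtain i where "int n - h = 2 * i" by (elim evenE)
        with h show "h \<in> (\<lambda>i. int n - 2 * int i) ` {..n}"
          by (intro image_eqI[of _ _ "nat i"]) auto
      qed
    qed
    show "(\<lambda>i. (int n - 2 * int i) mod (2 * int N)) ` {..n} = slice N (Suc n)"
      using True by (simp add: slice_def image_image flip: eq)
  qed
  then show ?thesis using True bij_betw_same_card by fastforce
next
  case False
  have "bij_betw (\<lambda>i. 2 * int i + int n mod 2) {..<N} (slice N (Suc n))"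
  proof (rule bij_betw_imageI)
    show "inj_on (\<lambda>i. 2 * int i + int n mod 2) {..<N}" by (auto simp: inj_on_def)
    show "(\<lambda>i. 2 * int i + int n mod 2) ` {..<N} = slice N (Suc n)"
    proof
      show "(\<lambda>i. 2 * int i + int n mod 2) ` {..<N} \<subseteq> slice N (Suc n)"
        using False by (auto simp: slice_def cong_def)
      show "slice N (Suc n) \<subseteq> (\<lambda>i. 2 * int i + int n mod 2) ` {..<N}"
      proof
        fix h assume "h \<in> slice N (Suc n)"
        then have h: "0 \<le> h" "h < 2 * int N" "h mod 2 = int n mod 2"
          using False by (auto simp: slice_def cong_def)
        have "h = 2 * (h div 2) + h mod 2" by simp
        moreover have "0 \<le> h div 2" "h div 2 < int N" using h by simp_all
        ultimately show "h \<in> (\<lambda>i. 2 * int i + int n mod 2) ` {..<N}"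
          using h(3) by (intro image_eqI[of _ _ "nat (h div 2)"]) auto
      qed
    qed
  qed
  then show ?thesis using False bij_betw_same_card by fastforce
qed

text \<open>A later time belongs to a smaller partition, so the partitions grow to the right exactly
  where \<open>t\<close> decreases.\<close>

definition up_steps :: "nat \<Rightarrow> (int \<Rightarrow> int) \<Rightarrow> int set" where
  "up_steps N t = {h \<in> cyc N. t (rt N h) < t h}"

text \<open>
  A position at time \<open>t\<close> has weight \<open>a q^(t+1)\<close> at a peak, \<open>1/(a q^(t-1))\<close> at a valley, and \<open>q\<close>
  on a slope.
\<close>

definition profile_weight :: "nat \<Rightarrow> real \<Rightarrow> real \<Rightarrow> (int \<Rightarrow> int) \<Rightarrow> int \<Rightarrow> real" where
  "profile_weight N a q t h =
     q * (if t h < t (lt N h) then a * q ^ nat (t h) else 1)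
       / (if t (rt N h) < t h then a * q ^ nat (t h) else 1)"

lemma up_steps_cong: "1 \<le> N \<Longrightarrow> (\<And>h. h \<in> cyc N \<Longrightarrow> t h = t' h) \<Longrightarrow> up_steps N t = up_steps N t'"
  by (auto simp: up_steps_def)

lemma profile_weight_cong:
  "1 \<le> N \<Longrightarrow> (\<And>h. h \<in> cyc N \<Longrightarrow> t h = t' h) \<Longrightarrow> h \<in> cyc N \<Longrightarrow>
     profile_weight N a q t h = profile_weight N a q t' h"
  by (simp add: profile_weight_def)

lemma profile_weight_pos: "0 < a \<Longrightarrow> 0 < q \<Longrightarrow> profile_weight N a q t h > 0"
  by (simp add: profile_weight_def)

lemma weight_cong: "(\<And>h. h \<in> cyc N \<Longrightarrow> c h = c' h) \<Longrightarrow> weight N c \<Lambda> = weight N c' \<Lambda>"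
  by (simp add: weight_def)

lemma up_steps_peak:
  assumes N: "1 \<le> N" and h: "h \<in> cyc N" "t (lt N h) = t h + 1" "t (rt N h) = t h + 1"
  shows "up_steps N (t(h := t h + 2)) = insert h (up_steps N t - {lt N h})"
proof -
  have "rt N k = h \<longleftrightarrow> k = lt N h" if "k \<in> cyc N" for k using that h by auto
  then show ?thesis using N h by (auto simp: up_steps_def)
qed

text \<open>Raising a local minimum by 2 reverses every comparison with \<open>h\<close>. At a
  neighbour, whose time is \<open>t h + 1\<close>, this inserts its factor in the numerator or
  cancels it in the denominator; that factor has exponent \<open>t h + 1\<close> and so equals the
  weight of the removed peak.\<close>

lemma removal_weights_profile:
  assumes N: "1 \<le> N" and h: "h \<in> cyc N" "t (lt N h) = t h + 1" "t (rt N h) = t h + 1" "0 \<le> t h"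
    and aq: "0 < a" "0 < q" and k: "k \<in> cyc N"
  shows "removal_weights N h (profile_weight N a q t) k = profile_weight N a q (t(h := t h + 2)) k"
proof (cases "k = h")
  case True
  have "q ^ nat (t h + 2) = q ^ nat (t h) * (q * q)"
    using h(4) by (simp add: nat_add_distrib power_add power2_eq_square)
  then show ?thesis
    using True aq h by (simp add: removal_weights_def profile_weight_def field_simps)
next
  case False
  have eqs: "rt N k = h \<longleftrightarrow> k = lt N h" "lt N k = h \<longleftrightarrow> k = rt N h" using k h by auto
  have q1: "q ^ nat (t h + 1) = q ^ nat (t h) * q"
    using h(4) by (simp add: nat_add_distrib)
  have c: "profile_weight N a q t h = a * q ^ nat (t h) * q"
    using h by (simp add: profile_weight_def)
  let ?t' = "t(h := t h + 2)" and ?\<alpha> = "a * q ^ nat (t k)"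
  have up: "(if t k < ?t' (lt N k) then ?\<alpha> else 1) =
      (if t k < t (lt N k) then ?\<alpha> else 1) * (if k = rt N h then a * q ^ nat (t h) * q else 1)"
  proof (cases "k = rt N h")
    case True
    then have "lt N k = h" "t k = t h + 1" using h k by auto
    then show ?thesis using True False q1 by simp
  qed (use False eqs in simp)
  have down: "(if t (rt N k) < t k then ?\<alpha> else 1) =
      (if ?t' (rt N k) < t k then ?\<alpha> else 1) * (if k = lt N h then a * q ^ nat (t h) * q else 1)"
  proof (cases "k = lt N h")
    case True
    then have "rt N k = h" "t k = t h + 1" using h k by auto
    then show ?thesis using True False q1 by simp
  qed (use False eqs in simp)
  \<comment> \<open>\<open>x\<close> is the factor gained at \<open>rt N h\<close> and
    \<open>y\<close> the one gained at \<open>lt N h\<close>; for \<open>N = 1\<close> both occur at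
    the same position.\<close>
  have alg: "q * L / R * y * x = q * L' / R'"
    if "L' = L * x" "R = R' * y" "y \<noteq> 0" for L L' R R' x y :: real
    using that by simp
  have tk: "?t' k = t k" using False by simp
  show ?thesis
    unfolding removal_weights_def c if_not_P[OF False]
    unfolding profile_weight_def tk
    by (rule alg[OF up down]) (use aq in auto)
qed

text \<open>The profile once \<open>n\<close> slices and the squares \<open>A\<close> of slice
  \<open>n + 1\<close> are gone. A constant level would not have unit steps, so positions of the
  wrong parity are lifted to \<open>n + 1\<close>; further out the initial profile
  \<open>pos\<close> still stands.\<close>

definition time :: "nat \<Rightarrow> nat \<Rightarrow> int set \<Rightarrow> int \<Rightarrow> int" where
  "time N n A h = max (pos N h) (int n + (if even (h + int n) then 0 else 1)) + (if h \<in> A then 2 else 0)"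

text \<open>Squares of one slice have equal parity and are never adjacent, so each remaining one is
  a local minimum whatever part \<open>A\<close> of the slice is gone, and they can be removed in
  any order.\<close>

lemma time_slice:
  assumes "1 \<le> N" "A \<subseteq> slice N (Suc n)" "h \<in> slice N (Suc n)" "h \<notin> A"
  shows "time N n A h = int n" "time N n A (lt N h) = int n + 1" "time N n A (rt N h) = int n + 1"
proof -
  have h: "h \<in> cyc N" "even (h + int n)" "pos N h \<le> int n"
    using assms by (auto simp: slice_Suc)
  have "lt N h \<notin> A" "rt N h \<notin> A"
    using assms(1,2) h(2) by (auto simp: slice_Suc)
  moreover have "odd (lt N h + int n)" "odd (rt N h + int n)" using h(2) by auto
  ultimately show "time N n A h = int n" "time N n A (lt N h) = int n + 1" "time N n A (rt N h) = int n + 1"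
    using h pos_nbr[OF h(1)] assms(4) by (auto simp: time_def)
qed

lemma time_insert: "h \<notin> A \<Longrightarrow> time N n (insert h A) = (time N n A)(h := time N n A h + 2)"
  by (auto simp: time_def fun_eq_iff)

lemma time_Suc:
  assumes "1 \<le> N" "h \<in> cyc N"
  shows "time N n (slice N (Suc n)) h = time N (Suc n) {} h"
proof (cases "even (h + int n)")
  case True
  then have e: "even h \<longleftrightarrow> even n" by simp
  show ?thesis
  proof (cases "pos N h \<le> int n")
    case False
    \<comment> \<open>\<open>pos N h\<close> has the parity of \<open>n\<close>, so it exceeds
      \<open>n\<close> by at least 2 and already reaches the lifted value \<open>n + 2\<close> of
      the next level.\<close>
    have "pos N h \<noteq> int n + 1" using e by (metis even_pos even_plus_one_iff even_of_nat)
    with False show ?thesis using True assms by (auto simp: time_def slice_Suc)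
  qed (use True assms in \<open>auto simp: time_def slice_Suc\<close>)
next
  case False
  then show ?thesis using assms by (auto simp: time_def slice_Suc)
qed

lemma time_0: "h \<in> cyc N \<Longrightarrow> time N 0 {} h = pos N h"
  using pos_bounds(1)[of h N] even_pos[of N h] by (cases "pos N h = 0") (auto simp: time_def)

section \<open>Last passage times over finitely many slices\<close>

text \<open>
  \<open>b\<close> prescribes boundary values below slice \<open>n\<close>; the bound \<open>m = \<infinity>\<close> makes the condition void, which
  is how total masses are obtained.
\<close>

definition lpp_le :: "nat \<Rightarrow> (int \<times> nat \<Rightarrow> nat) \<Rightarrow> nat \<Rightarrow> (int \<Rightarrow> nat) \<Rightarrow> enat \<Rightarrow> bool" where
  "lpp_le N w n b m \<longleftrightarrow> (\<forall>p\<in>paths N. enat ((\<Sum>j\<in>{1..n}. w (p j, j)) + b (p (Suc n))) \<le> m)"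

text \<open>One backward step of the percolation recursion, restricted to the positions in
  \<open>A\<close>. It changes boundary values exactly as the growth rule changes first
  parts.\<close>

definition lpp_update :: "nat \<Rightarrow> int set \<Rightarrow> nat \<Rightarrow> (int \<times> nat \<Rightarrow> nat) \<Rightarrow> (int \<Rightarrow> nat) \<Rightarrow> int \<Rightarrow> nat" where
  "lpp_update N A k w b x = (if x \<in> A then max (b (lt N x)) (b (rt N x)) + w (x, k) else b x)"

lemma lpp_update_empty [simp]: "lpp_update N {} k v b = b"
  by (simp add: lpp_update_def fun_eq_iff)

lemma path_in_slice: "1 \<le> N \<Longrightarrow> p \<in> paths N \<Longrightarrow> 1 \<le> k \<Longrightarrow> p k \<in> slice N k"
  using path_in_squares by (auto simp: squares_def)

lemma path_in_cyc: "1 \<le> N \<Longrightarrow> p \<in> paths N \<Longrightarrow> 1 \<le> k \<Longrightarrow> p k \<in> cyc N"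
  using path_in_slice slice_subset_cyc by blast

lemma path_step: "p \<in> paths N \<Longrightarrow> 1 \<le> k \<Longrightarrow> p (Suc k) = rt N (p k) \<or> p (Suc k) = lt N (p k)"
  by (auto simp: paths_def rt_def lt_def)

text \<open>Paths are infinite, so after the altered step the path continues forever in the
  direction of that step.\<close>

lemma path_redirect:
  assumes "p \<in> paths N" "1 \<le> n" "y = lt N (p n) \<or> y = rt N (p n)"
  obtains p' where "p' \<in> paths N" "\<And>j. j \<le> n \<Longrightarrow> p' j = p j" "p' (Suc n) = y"
proof -
  obtain s :: int where s: "s = 1 \<or> s = -1" "y = (p n + s) mod (2 * int N)"
  proof -
    consider "y = lt N (p n)" | "y = rt N (p n)" using assms(3) by blast
    then show thesis using that[of 1] that[of "-1"] by cases (auto simp: lt_def rt_def)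
  qed
  define p' where "p' j = (if j \<le> n then p j else (p n + s * (int j - int n)) mod (2 * int N))" for j
  have "p' (k + 1) = (p' k + s) mod (2 * int N)" if "n < k" for k
    using that by (simp add: p'_def mod_simps algebra_simps)
  moreover have "p' (n + 1) = (p' n + s) mod (2 * int N)" by (simp add: p'_def)
  ultimately have "p' (k + 1) = (p' k + s) mod (2 * int N)" if "n \<le> k" for k
    using that by (cases "n = k") auto
  then have "p' (k + 1) = (p' k + 1) mod (2 * int N) \<or> p' (k + 1) = (p' k - 1) mod (2 * int N)"
    if "n \<le> k" for k using s(1) that by (metis diff_conv_add_uminus)
  moreover have "p' (k + 1) = (p' k + 1) mod (2 * int N) \<or> p' (k + 1) = (p' k - 1) mod (2 * int N)"
    if "k < n" "1 \<le> k" for k using assms(1) that by (auto simp: p'_def paths_def)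
  moreover have "p' 1 = 0" using assms(1,2) by (auto simp: p'_def paths_def)
  ultimately have "p' \<in> paths N"
    unfolding paths_def by (blast intro: leI)
  then show thesis by (rule that) (auto simp: p'_def s)
qed

text \<open>Some path exists; otherwise a bound over all paths would be vacuous.\<close>

lemma zigzag_path: "(\<lambda>k. (int k - 1) mod (2 * int N)) \<in> paths N"
  by (auto simp: paths_def mod_simps)

lemma lpp_le_0: "lpp_le N w 0 b m \<longleftrightarrow> enat (b 0) \<le> m"
proof -
  have p: "p (Suc 0) = 0" if "p \<in> paths N" for p using that by (simp add: paths_def)
  have "lpp_le N w 0 b m \<longleftrightarrow> (\<forall>p\<in>paths N. enat (b 0) \<le> m)"
    unfolding lpp_le_def by (rule ball_cong[OF refl]) (simp add: p)
  then show ?thesis using zigzag_path[of N] by blast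
qed

text \<open>Dynamic programming from below: among the two steps out of slice \<open>n + 1\<close>
  only the one to the larger boundary value matters, so this slice can be absorbed into the
  boundary.\<close>

lemma lpp_le_Suc:
  assumes "1 \<le> N"
  shows "lpp_le N w (Suc n) b m \<longleftrightarrow> lpp_le N w n (lpp_update N (slice N (Suc n)) (Suc n) w b) m"
proof
  assume L: "lpp_le N w (Suc n) b m"
  show "lpp_le N w n (lpp_update N (slice N (Suc n)) (Suc n) w b) m"
    unfolding lpp_le_def
  proof
    fix p assume p: "p \<in> paths N"
    let ?x = "p (Suc n)"
    obtain y where y: "y = lt N ?x \<or> y = rt N ?x" "b y = max (b (lt N ?x)) (b (rt N ?x))"
      by (metis max_def)
    obtain p' where p': "p' \<in> paths N" "\<And>j. j \<le> Suc n \<Longrightarrow> p' j = p j" "p' (Suc (Suc n)) = y"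
      using path_redirect[OF p _ y(1)] by auto
    have "(\<Sum>j\<in>{1..Suc n}. w (p' j, j)) = (\<Sum>j\<in>{1..n}. w (p j, j)) + w (?x, Suc n)"
      by (simp add: p'(2))
    moreover have "enat ((\<Sum>j\<in>{1..Suc n}. w (p' j, j)) + b (p' (Suc (Suc n)))) \<le> m"
      using L p'(1) unfolding lpp_le_def by blast
    ultimately show "enat ((\<Sum>j\<in>{1..n}. w (p j, j)) + lpp_update N (slice N (Suc n)) (Suc n) w b ?x) \<le> m"
      using path_in_slice[OF assms p, of "Suc n"] p'(3) y(2) by (simp add: lpp_update_def add_ac)
  qed
next
  assume L: "lpp_le N w n (lpp_update N (slice N (Suc n)) (Suc n) w b) m"
  show "lpp_le N w (Suc n) b m"
    unfolding lpp_le_def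
  proof
    fix p assume p: "p \<in> paths N"
    let ?x = "p (Suc n)"
    have "b (p (Suc (Suc n))) \<le> max (b (lt N ?x)) (b (rt N ?x))"
      using path_step[OF p, of "Suc n"] by auto
    then have "(\<Sum>j\<in>{1..Suc n}. w (p j, j)) + b (p (Suc (Suc n))) \<le>
       (\<Sum>j\<in>{1..n}. w (p j, j)) + lpp_update N (slice N (Suc n)) (Suc n) w b ?x"
      using path_in_slice[OF assms p, of "Suc n"] by (simp add: lpp_update_def)
    also have "enat \<dots> \<le> m" using L p unfolding lpp_le_def by blast
    finally show "enat ((\<Sum>j\<in>{1..Suc n}. w (p j, j)) + b (p (Suc (Suc n)))) \<le> m" by simp
  qed
qed

lemma lpp_le_cong:
  assumes "1 \<le> N" "\<And>h k. 1 \<le> k \<Longrightarrow> k \<le> n \<Longrightarrow> h \<in> slice N k \<Longrightarrow> w (h, k) = w' (h, k)"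
    "\<And>h. h \<in> cyc N \<Longrightarrow> b h = b' h"
  shows "lpp_le N w n b m \<longleftrightarrow> lpp_le N w' n b' m"
proof -
  have "(\<Sum>j\<in>{1..n}. w (p j, j)) = (\<Sum>j\<in>{1..n}. w' (p j, j))" "b (p (Suc n)) = b' (p (Suc n))"
    if "p \<in> paths N" for p
    using path_in_slice[OF assms(1) that] path_in_cyc[OF assms(1) that]
    by (auto intro!: sum.cong assms(2,3))
  then show ?thesis unfolding lpp_le_def by (auto cong: ball_cong)
qed

text \<open>Squares of one slice are not adjacent, so updates within a slice never read each other's
  results.\<close>

lemma lpp_update_insert:
  assumes "1 \<le> N" "insert h A \<subseteq> slice N (Suc n)" "h \<notin> A"
  shows "lpp_update N (insert h A) k w b =
    lpp_update N A k w (b(h := max (b (lt N h)) (b (rt N h)) + w (h, k)))"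
proof
  fix x
  have "lt N x \<noteq> h \<and> rt N x \<noteq> h" if "x \<in> A"
  proof -
    have "even (x + int n)" "even (h + int n)" using assms that by (auto simp: slice_Suc)
    then show ?thesis by auto
  qed
  then show "lpp_update N (insert h A) k w b x =
    lpp_update N A k w (b(h := max (b (lt N h)) (b (rt N h)) + w (h, k))) x"
    using assms(3) by (auto simp: lpp_update_def)
qed

lemma last_passage_time_le_iff:
  "last_passage_time N w + enat c \<le> m \<longleftrightarrow> (\<forall>n. lpp_le N w n (\<lambda>_. c) m)"
proof -
  let ?S = "\<lambda>p n. \<Sum>j\<in>{1..n}. w (p j, j)"
  have S: "(\<Sum>i<n. enat (w (p (Suc i), Suc i))) = enat (?S p n)" for p n
    by (induction n) (simp_all add: zero_enat_def)
  have pl: "path_length w p = (SUP n. enat (?S p n))" for p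
    unfolding path_length_def suminf_eq_SUP S ..
  have L: "last_passage_time N w \<le> x \<longleftrightarrow> (\<forall>p\<in>paths N. \<forall>n. enat (?S p n) \<le> x)" for x
    unfolding last_passage_time_def pl by (auto simp: SUP_le_iff)
  \<comment> \<open>Moving \<open>c\<close> to the other side requires a finite bound that is at
    least \<open>c\<close>. For a smaller finite bound depth 0 already fails, and for an infinite
    one both sides hold.\<close>
  show ?thesis
  proof (cases "\<exists>r. m = enat r \<and> c \<le> r")
    case True
    then obtain r where r: "m = enat r" "c \<le> r" by blast
    have "last_passage_time N w + enat c \<le> m \<longleftrightarrow> last_passage_time N w \<le> enat (r - c)"
      using r by (cases "last_passage_time N w") auto
    also have "\<dots> \<longleftrightarrow> (\<forall>n. lpp_le N w n (\<lambda>_. c) m)"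
      unfolding L using r by (auto simp: lpp_le_def le_diff_conv2)
    finally show ?thesis .
  next
    case False
    show ?thesis
    proof (cases m)
      case (enat r)
      have "\<not> lpp_le N w 0 (\<lambda>_. c) m" using False enat by (auto simp: lpp_le_0)
      moreover have "\<not> last_passage_time N w + enat c \<le> m"
        using False enat by (cases "last_passage_time N w") auto
      ultimately show ?thesis by blast
    qed (auto simp: lpp_le_def)
  qed
qed

section \<open>Removing the slices one by one\<close>

locale cylindric_lpp = prob_space M
  for M :: "'a measure" +
  fixes N :: nat and a q :: real and w :: "int \<times> nat \<Rightarrow> 'a \<Rightarrow> nat"
  assumes N: "1 \<le> N" and a: "0 < a" "a < 1" and q: "0 < q" "q < 1"
    and indep: "indep_vars (\<lambda>_. count_space UNIV) w (squares N)"
    and geom: "\<And>h k. (h, k) \<in> squares N \<Longrightarrow>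
           distr M (count_space UNIV) (w (h, k)) = measure_pmf (Geom (a * q ^ k))"
begin

lemma measurable_weights:
  assumes "s \<in> squares N"
  shows "w s \<in> M \<rightarrow>\<^sub>M count_space UNIV"
  using indep assms by (simp add: indep_vars_def)

lemma aq_bounds: "0 < a * q ^ k" "a * q ^ k < 1"
proof -
  have "q ^ k \<le> 1" using q by (simp add: power_le_one)
  then have "a * q ^ k \<le> a * 1" using a by (intro mult_left_mono) auto
  then show "a * q ^ k < 1" using a by linarith
qed (use a q in auto)

lemma prob_weight_eq:
  assumes "(h, k) \<in> squares N"
  shows "prob {\<omega> \<in> space M. w (h, k) \<omega> = G} = (1 - a * q ^ k) * (a * q ^ k) ^ G"
proof -
  have "prob {\<omega> \<in> space M. w (h, k) \<omega> = G} = measure (distr M (count_space UNIV) (w (h, k))) {G}"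
    using measurable_weights[OF assms]
    by (subst measure_distr) (auto simp: vimage_def Int_def conj_commute)
  also have "\<dots> = (1 - a * q ^ k) * (a * q ^ k) ^ G"
    using aq_bounds[of k] by (simp add: geom[OF assms] measure_pmf_single pmf_Geom)
  finally show ?thesis .
qed

lemma vimage_Pair_Int: "(\<lambda>x. (f x, g x)) -` (A \<times> B) \<inter> S = (f -` A \<inter> S) \<inter> (g -` B \<inter> S)"
  by auto

text \<open>Finitely many weights take values in a countable product with discrete sigma-algebra, so
  \<open>Q\<close> may be any predicate that depends on them only.\<close>

lemma
  assumes J: "finite J" "J \<subseteq> squares N" and Q: "\<And>f g. (\<forall>s\<in>J. f s = g s) \<Longrightarrow> Q f = Q g"
  shows measurable_finite_dependence: "{\<omega> \<in> space M. Q (\<lambda>s. w s \<omega>)} \<in> events"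
    and prob_finite_dependence: "s \<in> squares N - J \<Longrightarrow>
      prob {\<omega> \<in> space M. w s \<omega> = G \<and> Q (\<lambda>s. w s \<omega>)} =
      prob {\<omega> \<in> space M. w s \<omega> = G} * prob {\<omega> \<in> space M. Q (\<lambda>s. w s \<omega>)}"
proof -
  have PiM: "PiM J (\<lambda>_. count_space (UNIV :: nat set)) = count_space (J \<rightarrow>\<^sub>E UNIV)"
    using J(1) by (intro count_space_PiM_finite) auto
  let ?w = "\<lambda>\<omega>. restrict (\<lambda>s. w s \<omega>) J" and ?F = "{f \<in> J \<rightarrow>\<^sub>E UNIV. Q f}"
  have pre: "?w -` ?F \<inter> space M = {\<omega> \<in> space M. Q (\<lambda>s. w s \<omega>)}"
  proof -
    have "Q (restrict (\<lambda>s. w s \<omega>) J) = Q (\<lambda>s. w s \<omega>)" for \<omega> by (rule Q) simp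
    then show ?thesis by (auto simp: PiE_iff)
  qed
  have "?w \<in> M \<rightarrow>\<^sub>M PiM J (\<lambda>_. count_space UNIV)"
    using J measurable_weights by (intro measurable_restrict) auto
  then have "?w -` ?F \<inter> space M \<in> events"
    unfolding PiM by (rule measurable_sets) auto
  then show "{\<omega> \<in> space M. Q (\<lambda>s. w s \<omega>)} \<in> events" unfolding pre .
  assume s: "s \<in> squares N - J"
  have PiM1: "PiM {s} (\<lambda>_. count_space (UNIV :: nat set)) = count_space ({s} \<rightarrow>\<^sub>E UNIV)"
    by (intro count_space_PiM_finite) auto
  let ?v = "\<lambda>\<omega>. restrict (\<lambda>s. w s \<omega>) {s}" and ?E = "{f \<in> {s} \<rightarrow>\<^sub>E UNIV. f s = G}"
  have "indep_var (PiM {s} (\<lambda>_. count_space UNIV)) ?v (PiM J (\<lambda>_. count_space UNIV)) ?w"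
    using s J by (intro indep_var_restrict[OF indep]) auto
  from indep_varD[OF this, of ?E ?F]
  have "prob ((\<lambda>\<omega>. (?v \<omega>, ?w \<omega>)) -` (?E \<times> ?F) \<inter> space M) =
      prob (?v -` ?E \<inter> space M) * prob (?w -` ?F \<inter> space M)"
    unfolding PiM PiM1 by auto
  moreover have "?v -` ?E \<inter> space M = {\<omega> \<in> space M. w s \<omega> = G}"
    by (auto simp: PiE_iff)
  moreover have "(\<lambda>\<omega>. (?v \<omega>, ?w \<omega>)) -` (?E \<times> ?F) \<inter> space M =
      (?v -` ?E \<inter> space M) \<inter> (?w -` ?F \<inter> space M)"
    by (rule vimage_Pair_Int)
  moreover have "{\<omega> \<in> space M. w s \<omega> = G \<and> Q (\<lambda>s. w s \<omega>)} =
      {\<omega> \<in> space M. w s \<omega> = G} \<inter> {\<omega> \<in> space M. Q (\<lambda>s. w s \<omega>)}"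
    by blast
  ultimately show "prob {\<omega> \<in> space M. w s \<omega> = G \<and> Q (\<lambda>s. w s \<omega>)} =
      prob {\<omega> \<in> space M. w s \<omega> = G} * prob {\<omega> \<in> space M. Q (\<lambda>s. w s \<omega>)}"
    unfolding pre by simp
qed

definition squares_upto :: "nat \<Rightarrow> int set \<Rightarrow> (int \<times> nat) set" where
  "squares_upto n A = (\<lambda>(k, h). (h, k)) ` (SIGMA k:{1..n}. slice N k) \<union> A \<times> {Suc n}"

lemma squares_upto_subset: "A \<subseteq> slice N (Suc n) \<Longrightarrow> squares_upto n A \<subseteq> squares N"
  by (auto simp: squares_upto_def squares_def)

lemma finite_squares_upto: "A \<subseteq> slice N (Suc n) \<Longrightarrow> finite (squares_upto n A)"
  using finite_slice[OF N] finite_subset[of A "slice N (Suc n)"] by (auto simp: squares_upto_def intro!: finite_imageI finite_SigmaI)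

definition lpp_event :: "nat \<Rightarrow> int set \<Rightarrow> enat \<Rightarrow> (int \<Rightarrow> nat) \<Rightarrow> 'a set" where
  "lpp_event n A m b =
     {\<omega> \<in> space M. lpp_le N (\<lambda>s. w s \<omega>) n (lpp_update N A (Suc n) (\<lambda>s. w s \<omega>) b) m}"

lemma lpp_le_dependence:
  assumes "\<forall>s\<in>squares_upto n A. f s = g s"
  shows "lpp_le N f n (lpp_update N A (Suc n) f b) m = lpp_le N g n (lpp_update N A (Suc n) g b) m"
proof (rule lpp_le_cong[OF N])
  fix h k assume "1 \<le> k" "k \<le> n" "h \<in> slice N k"
  then have "(h, k) \<in> squares_upto n A" by (force simp: squares_upto_def)
  then show "f (h, k) = g (h, k)" using assms by blast
next
  fix h
  have "(h, Suc n) \<in> squares_upto n A" if "h \<in> A" using that by (auto simp: squares_upto_def)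
  then show "lpp_update N A (Suc n) f b h = lpp_update N A (Suc n) g b h"
    using assms by (auto simp: lpp_update_def)
qed

lemma lpp_event_measurable: "A \<subseteq> slice N (Suc n) \<Longrightarrow> lpp_event n A m b \<in> events"
  unfolding lpp_event_def
  by (rule measurable_finite_dependence[OF finite_squares_upto squares_upto_subset lpp_le_dependence])

text \<open>Disintegration by the value \<open>G\<close> of the weight at the new square, which is
  independent of the event for \<open>A\<close>. Its geometric law is
  \<open>1 - a * q ^ Suc n\<close> times the powers summed here, whence the factor.\<close>

lemma lpp_event_insert:
  assumes "insert h A \<subseteq> slice N (Suc n)" "h \<notin> A"
  shows "(\<integral>\<^sup>+G. ennreal ((a * q ^ Suc n) ^ G) *
        emeasure M (lpp_event n A m (b(h := max (b (lt N h)) (b (rt N h)) + G))) \<partial>count_space UNIV) =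
      ennreal (1 / (1 - a * q ^ Suc n)) * emeasure M (lpp_event n (insert h A) m b)"
proof -
  let ?p = "a * q ^ Suc n" and ?s = "(h, Suc n)"
  let ?b = "\<lambda>G. b(h := max (b (lt N h)) (b (rt N h)) + G)"
  have A: "A \<subseteq> slice N (Suc n)" using assms by blast
  have s: "?s \<in> squares N" using assms by (auto simp: squares_def)
  have s': "?s \<notin> squares_upto n A" using assms by (auto simp: squares_upto_def)
  define E where "E G = {\<omega> \<in> space M. w ?s \<omega> = G \<and>
      lpp_le N (\<lambda>s. w s \<omega>) n (lpp_update N A (Suc n) (\<lambda>s. w s \<omega>) (?b G)) m}" for G
  have Eeq: "E G = {\<omega> \<in> space M. w ?s \<omega> = G} \<inter> lpp_event n A m (?b G)" for G
    by (auto simp: E_def lpp_event_def)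
  have E: "E G \<in> events" for G
    unfolding Eeq using measurable_weights[OF s] lpp_event_measurable[OF A]
    by (intro sets.Int) (auto intro: measurable_sets_Collect)
  have prob: "emeasure M (E G) = ennreal ((1 - ?p) * ?p ^ G) * emeasure M (lpp_event n A m (?b G))" for G
  proof -
    have "prob (E G) = prob {\<omega> \<in> space M. w ?s \<omega> = G} * prob (lpp_event n A m (?b G))"
      unfolding E_def lpp_event_def
      by (rule prob_finite_dependence[OF finite_squares_upto[OF A] squares_upto_subset[OF A]
            lpp_le_dependence]) (use s s' in auto)
    then show ?thesis
      unfolding emeasure_eq_measure prob_weight_eq[OF s] using aq_bounds[of "Suc n"]
      by (simp add: ennreal_mult del: power_Suc)
  qed
  have "lpp_event n (insert h A) m b = (\<Union>G. E G)"
    unfolding lpp_event_def E_def lpp_update_insert[OF N assms] by auto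
  then have "emeasure M (lpp_event n (insert h A) m b) = (\<Sum>G. emeasure M (E G))"
    using E by (subst suminf_emeasure) (auto simp: disjoint_family_on_def E_def)
  also have "\<dots> = (\<integral>\<^sup>+G. ennreal (1 - ?p) * (ennreal (?p ^ G) * emeasure M (lpp_event n A m (?b G)))
      \<partial>count_space UNIV)"
    unfolding nn_integral_count_space_nat[symmetric] prob
    using aq_bounds[of "Suc n"] by (intro nn_integral_cong) (simp add: ennreal_mult mult.assoc del: power_Suc)
  also have "\<dots> = ennreal (1 - ?p) *
      (\<integral>\<^sup>+G. ennreal (?p ^ G) * emeasure M (lpp_event n A m (?b G)) \<partial>count_space UNIV)"
    by (intro nn_integral_cmult) auto
  finally have "ennreal (1 / (1 - ?p)) * emeasure M (lpp_event n (insert h A) m b) =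
     ennreal (1 / (1 - ?p)) * ennreal (1 - ?p) *
      (\<integral>\<^sup>+G. ennreal (?p ^ G) * emeasure M (lpp_event n A m (?b G)) \<partial>count_space UNIV)"
    by (simp only: mult.assoc)
  also have "ennreal (1 / (1 - ?p)) * ennreal (1 - ?p) = 1"
    using aq_bounds[of "Suc n"] by (simp add: ennreal_mult'[symmetric] del: power_Suc)
  finally show ?thesis by (simp only: mult_1_left)
qed

section \<open>The quantity propagated by the removal of squares\<close>

definition partition_fun :: "nat \<Rightarrow> int set \<Rightarrow> enat \<Rightarrow> ennreal" where
  "partition_fun n A m =
     (\<integral>\<^sup>+\<Lambda>. ennreal (weight N (profile_weight N a q (time N n A)) \<Lambda>) *
        emeasure M (lpp_event n A m (\<lambda>h. \<Lambda> h 0))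
      \<partial>count_space (configs N (up_steps N (time N n A))))"

text \<open>The inner sum left by the removal of the peak at \<open>h\<close> is the left side of
  \<open>lpp_event_insert\<close>, because the grown first part is the updated boundary
  value.\<close>

lemma partition_fun_insert:
  assumes "insert h A \<subseteq> slice N (Suc n)" "h \<notin> A"
  shows "partition_fun n A m = ennreal (1 / (1 - a * q ^ Suc n)) * partition_fun n (insert h A) m"
proof -
  let ?t = "time N n A" and ?t' = "time N n (insert h A)"
  let ?c = "profile_weight N a q ?t"
  have h: "h \<in> cyc N" using assms slice_subset_cyc[OF N, of "Suc n"] by auto
  have t: "?t h = int n" "?t (lt N h) = ?t h + 1" "?t (rt N h) = ?t h + 1"
    using time_slice[OF N _ _ assms(2), of n] assms(1) by auto
  have t': "?t' = ?t(h := ?t h + 2)" by (rule time_insert[OF assms(2)])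
  have ch: "?c h = a * q ^ Suc n" using t by (simp add: profile_weight_def)
  have up: "up_steps N ?t' = insert h (up_steps N ?t - {lt N h})"
    unfolding t' by (rule up_steps_peak[OF N h t(2,3)])
  have wt: "weight N (removal_weights N h ?c) \<Lambda> = weight N (profile_weight N a q ?t') \<Lambda>" for \<Lambda>
    unfolding t' by (intro weight_cong removal_weights_profile[OF N h t(2,3)]) (use t a q in auto)
  have "partition_fun n A m =
    (\<integral>\<^sup>+\<Lambda>. ennreal (weight N (profile_weight N a q ?t') \<Lambda>) *
       (\<integral>\<^sup>+G. ennreal ((a * q ^ Suc n) ^ G) * emeasure M (lpp_event n A m
           (\<lambda>x. (\<Lambda>(h := growth (\<Lambda> (lt N h)) (\<Lambda> (rt N h)) G (\<Lambda> h))) x 0)) \<partial>count_space UNIV)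
     \<partial>count_space (configs N (up_steps N ?t')))"
    unfolding partition_fun_def up wt[symmetric] ch[symmetric]
  proof (rule nn_integral_peak_removal[OF N h])
    show "lt N h \<in> up_steps N ?t" "h \<notin> up_steps N ?t"
      using N h t by (auto simp: up_steps_def)
    show "0 < ?c h" by (rule profile_weight_pos[OF a(1) q(1)])
  qed
  also have "\<dots> =
    (\<integral>\<^sup>+\<Lambda>. ennreal (weight N (profile_weight N a q ?t') \<Lambda>) *
       (ennreal (1 / (1 - a * q ^ Suc n)) * emeasure M (lpp_event n (insert h A) m (\<lambda>x. \<Lambda> x 0)))
     \<partial>count_space (configs N (up_steps N ?t')))"
  proof (intro nn_integral_cong arg_cong2[where f = "(*)"] refl)
    fix \<Lambda> :: "int \<Rightarrow> nat \<Rightarrow> nat"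
    have "(\<lambda>x. (\<Lambda>(h := growth (\<Lambda> (lt N h)) (\<Lambda> (rt N h)) G (\<Lambda> h))) x 0) =
        (\<lambda>x. \<Lambda> x 0)(h := max (\<Lambda> (lt N h) 0) (\<Lambda> (rt N h) 0) + G)" for G
      by (auto simp: fun_eq_iff)
    then show "(\<integral>\<^sup>+G. ennreal ((a * q ^ Suc n) ^ G) * emeasure M (lpp_event n A m
           (\<lambda>x. (\<Lambda>(h := growth (\<Lambda> (lt N h)) (\<Lambda> (rt N h)) G (\<Lambda> h))) x 0)) \<partial>count_space UNIV) =
       ennreal (1 / (1 - a * q ^ Suc n)) * emeasure M (lpp_event n (insert h A) m (\<lambda>x. \<Lambda> x 0))"
      using lpp_event_insert[OF assms, of m "\<lambda>x. \<Lambda> x 0"] by (simp only:)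
  qed
  also have "\<dots> = ennreal (1 / (1 - a * q ^ Suc n)) * partition_fun n (insert h A) m"
    unfolding partition_fun_def by (subst nn_integral_cmult[symmetric]) (auto simp: mult_ac)
  finally show ?thesis .
qed

lemma partition_fun_Suc:
  "partition_fun n {} m = ennreal (1 / (1 - a * q ^ Suc n)) ^ min (Suc n) N * partition_fun (Suc n) {} m"
proof -
  let ?S = "slice N (Suc n)"
  have "partition_fun n {} m = ennreal (1 / (1 - a * q ^ Suc n)) ^ card A * partition_fun n A m"
    if "finite A" "A \<subseteq> ?S" for A
    using that
  proof (induction rule: finite_induct)
    case (insert h A)
    then show ?case
      by (simp add: partition_fun_insert[OF insert.prems insert.hyps(2)] mult_ac power_Suc[of _ "card A"]
          del: power_Suc)
  qed simp
  from this[of ?S]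
  have "partition_fun n {} m = ennreal (1 / (1 - a * q ^ Suc n)) ^ min (Suc n) N * partition_fun n ?S m"
    using finite_slice[OF N, of "Suc n"] by (simp only: card_slice[OF N])
  moreover have "partition_fun n ?S m = partition_fun (Suc n) {} m"
  proof -
    have "up_steps N (time N n ?S) = up_steps N (time N (Suc n) {})"
      using time_Suc[OF N] by (intro up_steps_cong N) auto
    moreover have "weight N (profile_weight N a q (time N n ?S)) \<Lambda> =
        weight N (profile_weight N a q (time N (Suc n) {})) \<Lambda>" for \<Lambda>
      using time_Suc[OF N] by (intro weight_cong profile_weight_cong N) auto
    moreover have "lpp_event n ?S m b = lpp_event (Suc n) {} m b" for b
      by (simp add: lpp_event_def lpp_le_Suc[OF N])
    ultimately show ?thesis unfolding partition_fun_def by simp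
  qed
  ultimately show ?thesis by simp
qed

lemma partition_fun_0:
  "partition_fun 0 {} m = ennreal (\<Prod>k=1..n. (1 / (1 - a * q ^ k)) ^ min k N) * partition_fun n {} m"
proof (induction n)
  case (Suc n)
  have "0 \<le> (\<Prod>k=1..n. (1 / (1 - a * q ^ k)) ^ min k N)"
    using aq_bounds by (intro prod_nonneg) (auto simp: less_imp_le)
  moreover have "0 \<le> 1 / (1 - a * q ^ Suc n)"
    using aq_bounds(2)[of "Suc n"] by (simp del: power_Suc)
  ultimately show ?case
    by (subst Suc, subst partition_fun_Suc)
       (simp add: ennreal_mult ennreal_power mult.assoc del: power_Suc)
qed simp

end

section \<open>Infinite products and the partition generating function\<close>

lemma qpoch_LIMSEQ:
  assumes "0 \<le> x" "0 \<le> u" "u < 1"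
  shows "(\<lambda>n. \<Prod>i<n. 1 - x * u ^ i) \<longlonglongrightarrow> qpoch x u"
  and "x < 1 \<Longrightarrow> qpoch x u > 0"
proof -
  have "summable (\<lambda>i. norm ((1 - x * u ^ i) - 1))"
    using assms by (simp add: abs_mult power_abs summable_geometric summable_mult)
  then have conv: "convergent_prod (\<lambda>i. 1 - x * u ^ i)"
    by (intro abs_convergent_prod_imp_convergent_prod summable_imp_abs_convergent_prod)
  from convergent_prod_LIMSEQ[OF this]
  show lim: "(\<lambda>n. \<Prod>i<n. 1 - x * u ^ i) \<longlonglongrightarrow> qpoch x u"
    unfolding qpoch_def by (simp add: LIMSEQ_lessThan_iff_atMost[where f = "\<lambda>A. \<Prod>i\<in>A. 1 - x * u ^ i"])
  assume x: "x < 1"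
  have pos: "x * u ^ i < 1" for i
  proof -
    have "x * u ^ i \<le> x * 1" using assms by (intro mult_left_mono) (auto simp: power_le_one)
    then show ?thesis using x by linarith
  qed
  \<comment> \<open>Positive partial products give only a nonnegative limit; that it does not vanish
    comes from convergence in the sense of infinite products.\<close>
  have "0 \<le> qpoch x u"
    using pos by (intro LIMSEQ_le_const[OF lim]) (auto intro!: prod_nonneg simp: less_imp_le)
  moreover have "qpoch x u \<noteq> 0"
    unfolding qpoch_def by (rule prodinf_nonzero[OF conv]) (use pos in \<open>auto simp: less_le\<close>)
  ultimately show "qpoch x u > 0" by simp
qed

lemma qpoch_split:
  assumes "0 \<le> x" "0 \<le> u" "u < 1"
  shows "qpoch x u = (\<Prod>i<m. 1 - x * u ^ i) * qpoch (x * u ^ m) u"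
proof (rule LIMSEQ_unique)
  show "(\<lambda>n. \<Prod>i<m + n. 1 - x * u ^ i) \<longlonglongrightarrow> qpoch x u"
    using LIMSEQ_ignore_initial_segment[OF qpoch_LIMSEQ(1)[OF assms], of m] by (simp add: add.commute)
  have "(\<Prod>i<m + n. 1 - x * u ^ i) = (\<Prod>i<m. 1 - x * u ^ i) * (\<Prod>i<n. 1 - x * u ^ m * u ^ i)" for n
    by (induction n) (simp_all add: power_add mult_ac)
  moreover have "(\<lambda>n. (\<Prod>i<m. 1 - x * u ^ i) * (\<Prod>i<n. 1 - x * u ^ m * u ^ i))
      \<longlonglongrightarrow> (\<Prod>i<m. 1 - x * u ^ i) * qpoch (x * u ^ m) u"
    using assms by (intro tendsto_mult tendsto_const qpoch_LIMSEQ) auto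
  ultimately show "(\<lambda>n. \<Prod>i<m + n. 1 - x * u ^ i) \<longlonglongrightarrow> (\<Prod>i<m. 1 - x * u ^ i) * qpoch (x * u ^ m) u"
    by simp
qed

text \<open>Sort the exponents by residue modulo \<open>N\<close>, writing
  \<open>i = r * N + j\<close>.\<close>

lemma qpoch_multisection:
  assumes "1 \<le> N" "0 \<le> x" "0 \<le> q" "q < 1"
  shows "(\<Prod>j<N. qpoch (x * q ^ j) (q ^ N)) = qpoch x q"
proof (rule LIMSEQ_unique)
  have qN: "0 \<le> q ^ N" "q ^ N < 1" using assms by (auto simp: power_less_one_iff)
  show "(\<lambda>R. \<Prod>j<N. \<Prod>r<R. 1 - x * q ^ j * (q ^ N) ^ r) \<longlonglongrightarrow> (\<Prod>j<N. qpoch (x * q ^ j) (q ^ N))"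
    using assms qN by (intro tendsto_prod qpoch_LIMSEQ) auto
  have "(\<Prod>j<N. \<Prod>r<R. 1 - x * q ^ j * (q ^ N) ^ r) = (\<Prod>i<R * N. 1 - x * q ^ i)" for R
  proof -
    have "(\<Prod>i<R * N. 1 - x * q ^ i) = (\<Prod>r<R. \<Prod>i = r * N..<r * N + N. 1 - x * q ^ i)"
      by (rule prod.nat_group[symmetric])
    also have "\<dots> = (\<Prod>r<R. \<Prod>j<N. 1 - x * q ^ j * (q ^ N) ^ r)"
    proof (rule prod.cong[OF refl])
      fix r
      show "(\<Prod>i = r * N..<r * N + N. 1 - x * q ^ i) = (\<Prod>j<N. 1 - x * q ^ j * (q ^ N) ^ r)"
        by (subst prod.atLeastLessThan_shift_0)
           (simp add: lessThan_atLeast0 power_add power_mult[symmetric] mult_ac)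
    qed
    also have "\<dots> = (\<Prod>j<N. \<Prod>r<R. 1 - x * q ^ j * (q ^ N) ^ r)" by (rule prod.swap)
    finally show ?thesis ..
  qed
  moreover have "strict_mono (\<lambda>R. R * N)" using assms(1) by (simp add: strict_mono_def)
  from LIMSEQ_subseq_LIMSEQ[OF qpoch_LIMSEQ(1)[OF assms(2-4)] this]
  have "(\<lambda>R. \<Prod>i<R * N. 1 - x * q ^ i) \<longlonglongrightarrow> qpoch x q" by (simp add: o_def)
  ultimately show "(\<lambda>R. \<Prod>j<N. \<Prod>r<R. 1 - x * q ^ j * (q ^ N) ^ r) \<longlonglongrightarrow> qpoch x q"
    by simp
qed

text \<open>The exponent \<open>min k N\<close> counts the \<open>i\<close> in \<open>{1..N}\<close>
  with \<open>i \<le> k\<close>. The factors belonging to one \<open>i\<close> converge to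
  \<open>inverse (qpoch (a * q ^ i) q)\<close>, which \<open>qpoch_multisection\<close> splits into
  the product over \<open>j\<close> in \<open>cpp_Z\<close>. The extra
  \<open>qpoch (q ^ N) (q ^ N)\<close> cancels the first factor of \<open>cpp_Z\<close>.\<close>

lemma cpp_Z_LIMSEQ:
  assumes "1 \<le> N" "0 < a" "a < 1" "0 < q" "q < 1"
  shows "(\<lambda>n. \<Prod>k=1..n. (1 / (1 - a * q ^ k)) ^ min k N)
    \<longlonglongrightarrow> cpp_Z N a q * qpoch (q ^ N) (q ^ N)"
proof -
  have "(\<lambda>n. \<Prod>i\<in>{1..N}. inverse (\<Prod>r<Suc n - i. 1 - a * q ^ i * q ^ r))
     \<longlonglongrightarrow> (\<Prod>i\<in>{1..N}. inverse (qpoch (a * q ^ i) q))"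
  proof (intro tendsto_prod tendsto_inverse)
    fix i
    have "(\<lambda>n. \<Prod>r<Suc n. 1 - a * q ^ i * q ^ r) \<longlonglongrightarrow> qpoch (a * q ^ i) q"
      using assms by (intro LIMSEQ_Suc qpoch_LIMSEQ) auto
    \<comment> \<open>\<open>Suc n - i\<close> truncates for small \<open>n\<close>; shifting the
      sequence by \<open>i\<close> avoids this and keeps the limit.\<close>
    then have "(\<lambda>n. \<Prod>r<Suc (n + i) - i. 1 - a * q ^ i * q ^ r) \<longlonglongrightarrow> qpoch (a * q ^ i) q"
      by (simp add: Suc_diff_le)
    then show "(\<lambda>n. \<Prod>r<Suc n - i. 1 - a * q ^ i * q ^ r) \<longlonglongrightarrow> qpoch (a * q ^ i) q"
      by (rule LIMSEQ_offset)
    have "q ^ i \<le> 1" using assms by (simp add: power_le_one)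
    then have "a * q ^ i \<le> a * 1" using assms by (intro mult_left_mono) auto
    then have "a * q ^ i < 1" using assms by linarith
    then show "qpoch (a * q ^ i) q \<noteq> 0"
      using qpoch_LIMSEQ(2)[of "a * q ^ i" q] assms by simp
  qed
  moreover have "(\<Prod>i\<in>{1..N}. inverse (\<Prod>r<Suc n - i. 1 - a * q ^ i * q ^ r)) =
      (\<Prod>k=1..n. (1 / (1 - a * q ^ k)) ^ min k N)" for n
  proof -
    have "inverse (\<Prod>r<Suc n - i. 1 - a * q ^ i * q ^ r) =
        (\<Prod>k=1..n. if i \<le> k then 1 / (1 - a * q ^ k) else 1)" if "i \<in> {1..N}" for i
    proof -
      have "(\<Prod>k=1..n. if i \<le> k then 1 / (1 - a * q ^ k) else 1) = (\<Prod>k\<in>{k\<in>{1..n}. i \<le> k}. 1 / (1 - a * q ^ k))"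
        by (rule prod.inter_filter[symmetric]) simp
      also have "{k\<in>{1..n}. i \<le> k} = {i..<Suc n}" using that by auto
      also have "(\<Prod>k\<in>{i..<Suc n}. 1 / (1 - a * q ^ k)) = (\<Prod>r<Suc n - i. 1 / (1 - a * q ^ i * q ^ r))"
        by (subst prod.atLeastLessThan_shift_0) (simp add: lessThan_atLeast0 power_add mult.assoc)
      finally show ?thesis by (simp add: prod_inversef inverse_eq_divide prod_dividef)
    qed
    then have "(\<Prod>i\<in>{1..N}. inverse (\<Prod>r<Suc n - i. 1 - a * q ^ i * q ^ r)) =
        (\<Prod>i\<in>{1..N}. \<Prod>k=1..n. if i \<le> k then 1 / (1 - a * q ^ k) else 1)"
      by (rule prod.cong[OF refl])
    also have "\<dots> = (\<Prod>k=1..n. \<Prod>i\<in>{1..N}. if i \<le> k then 1 / (1 - a * q ^ k) else 1)"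
      by (rule prod.swap)
    also have "\<dots> = (\<Prod>k=1..n. (1 / (1 - a * q ^ k)) ^ min k N)"
    proof (rule prod.cong[OF refl])
      fix k
      have "(\<Prod>i\<in>{1..N}. if i \<le> k then 1 / (1 - a * q ^ k) else 1) = (\<Prod>i\<in>{i\<in>{1..N}. i \<le> k}. 1 / (1 - a * q ^ k))"
        by (rule prod.inter_filter[symmetric]) simp
      also have "{i\<in>{1..N}. i \<le> k} = {1..min k N}" by auto
      finally show "(\<Prod>i\<in>{1..N}. if i \<le> k then 1 / (1 - a * q ^ k) else 1) = (1 / (1 - a * q ^ k)) ^ min k N"
        by simp
    qed
    finally show ?thesis .
  qed
  moreover have "(\<Prod>i\<in>{1..N}. inverse (qpoch (a * q ^ i) q)) = cpp_Z N a q * qpoch (q ^ N) (q ^ N)"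
  proof -
    have "(\<Prod>j\<in>{1..N}. inverse (qpoch (a * q ^ (i + j - 1)) (q ^ N))) = inverse (qpoch (a * q ^ i) q)"
      if "i \<in> {1..N}" for i
    proof -
      have "(\<Prod>j\<in>{1..N}. inverse (qpoch (a * q ^ (i + j - 1)) (q ^ N))) =
          (\<Prod>j<N. inverse (qpoch (a * q ^ i * q ^ j) (q ^ N)))"
        by (rule prod.reindex_bij_witness[of _ Suc "\<lambda>j. j - 1"]) (auto simp: power_add[symmetric] mult.assoc)
      also have "\<dots> = inverse (qpoch (a * q ^ i) q)"
        using assms qpoch_multisection[of N "a * q ^ i" q]
        by (simp add: prod_inversef[unfolded o_def])
      finally show ?thesis .
    qed
    then have "(\<Prod>i\<in>{1..N}. \<Prod>j\<in>{1..N}. inverse (qpoch (a * q ^ (i + j - 1)) (q ^ N))) =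
        (\<Prod>i\<in>{1..N}. inverse (qpoch (a * q ^ i) q))"
      by (rule prod.cong[OF refl])
    moreover have "qpoch (q ^ N) (q ^ N) \<noteq> 0"
      using qpoch_LIMSEQ(2)[of "q ^ N" "q ^ N"] assms by (simp add: power_less_one_iff)
    ultimately show ?thesis by (simp add: cpp_Z_def)
  qed
  ultimately show ?thesis by simp
qed

lemma cpp_Z_pos:
  assumes "1 \<le> N" "0 < a" "a < 1" "0 < q" "q < 1"
  shows "cpp_Z N a q > 0"
proof -
  have qN: "0 \<le> q ^ N" "q ^ N < 1" using assms by (auto simp: power_less_one_iff)
  have "a * q ^ k < 1" for k
  proof -
    have "a * q ^ k \<le> a * 1" using assms by (intro mult_left_mono) (auto simp: power_le_one)
    then show ?thesis using assms by linarith
  qed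
  then have "qpoch (a * q ^ k) (q ^ N) > 0" for k using assms qN by (intro qpoch_LIMSEQ(2)) auto
  then show ?thesis
    using qpoch_LIMSEQ(2)[of "q ^ N" "q ^ N"] qN unfolding cpp_Z_def
    by (intro mult_pos_pos prod_pos) auto
qed

section \<open>Generating function of partitions with bounded largest part\<close>

lemma psize_shift:
  assumes "\<kappa> \<in> partitions"
  shows "psize (\<lambda>i. if i < g then m else \<kappa> (i - g)) = m * g + psize \<kappa>"
proof -
  obtain n where n: "\<And>i. n \<le> i \<Longrightarrow> \<kappa> i = 0" using assms partitions_eventually_zero by blast
  let ?l = "\<lambda>i. if i < g then m else \<kappa> (i - g)"
  have "(\<Sum>i<g + r. ?l i) = m * g + (\<Sum>i<r. \<kappa> i)" for r by (induction r) auto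
  moreover have "psize ?l = (\<Sum>i<g + n. ?l i)" by (rule psize_eq_sum_lessThan) (use n in auto)
  ultimately have "psize ?l = m * g + (\<Sum>i<n. \<kappa> i)" by simp
  also have "(\<Sum>i<n. \<kappa> i) = psize \<kappa>" using n by (rule psize_eq_sum_lessThan[symmetric])
  finally show ?thesis .
qed

text \<open>A partition with parts at most \<open>Suc m\<close> is \<open>g\<close> copies of
  \<open>Suc m\<close> followed by a partition with parts at most \<open>m\<close>; the first index
  whose part is at most \<open>m\<close> recovers \<open>g\<close>. Summing over \<open>g\<close>
  gives one geometric series per step.\<close>

lemma bij_betw_partitions_Suc:
  "bij_betw (\<lambda>(g, \<kappa>) i. if i < g then Suc m else \<kappa> (i - g))
     (UNIV \<times> {\<kappa> \<in> partitions. \<kappa> 0 \<le> m}) {\<kappa> \<in> partitions. \<kappa> 0 \<le> Suc m}"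
proof (rule bij_betw_byWitness[where f' = "\<lambda>\<kappa>. let g = (LEAST i. \<kappa> i \<le> m) in (g, \<lambda>i. \<kappa> (i + g))"])
  show "\<forall>x\<in>UNIV \<times> {\<kappa> \<in> partitions. \<kappa> 0 \<le> m}.
     (\<lambda>\<kappa>. let g = (LEAST i. \<kappa> i \<le> m) in (g, \<lambda>i. \<kappa> (i + g)))
       ((\<lambda>(g, \<kappa>) i. if i < g then Suc m else \<kappa> (i - g)) x) = x"
  proof clarify
    fix g :: nat and \<kappa> :: "nat \<Rightarrow> nat" assume "\<kappa> 0 \<le> m"
    then have "(LEAST i. (if i < g then Suc m else \<kappa> (i - g)) \<le> m) = g"
      by (intro Least_equality) (auto split: if_splits intro: leI)
    then show "(let ga = LEAST i. (if i < g then Suc m else \<kappa> (i - g)) \<le> m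
        in (ga, \<lambda>i. if i + ga < g then Suc m else \<kappa> (i + ga - g))) = (g, \<kappa>)"
      by simp
  qed
  have least: "\<kappa> (LEAST i. \<kappa> i \<le> m) \<le> m" if k: "\<kappa> \<in> partitions" for \<kappa>
  proof -
    obtain n where "\<And>i. n \<le> i \<Longrightarrow> \<kappa> i = 0" using k partitions_eventually_zero by blast
    then have "\<kappa> n \<le> m" by simp
    then show ?thesis by (rule LeastI)
  qed
  show "\<forall>\<kappa>\<in>{\<kappa> \<in> partitions. \<kappa> 0 \<le> Suc m}. (\<lambda>(g, \<kappa>) i. if i < g then Suc m else \<kappa> (i - g))
      (let g = (LEAST i. \<kappa> i \<le> m) in (g, \<lambda>i. \<kappa> (i + g))) = \<kappa>"
  proof
    fix \<kappa> assume k: "\<kappa> \<in> {\<kappa> \<in> partitions. \<kappa> 0 \<le> Suc m}"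
    define g where "g = (LEAST i. \<kappa> i \<le> m)"
    have "\<kappa> i = Suc m" if "i < g" for i
    proof (rule antisym)
      have "\<kappa> i \<le> \<kappa> 0" using k partitions_antimono[of \<kappa> 0 i] by blast
      also have "\<dots> \<le> Suc m" using k by blast
      finally show "\<kappa> i \<le> Suc m" .
      show "Suc m \<le> \<kappa> i" using not_less_Least[OF that[unfolded g_def]] by simp
    qed
    then have "(\<lambda>i. if i < g then Suc m else \<kappa> (i - g + g)) = \<kappa>"
      by (auto simp: fun_eq_iff)
    then show "(\<lambda>(g, \<kappa>) i. if i < g then Suc m else \<kappa> (i - g))
      (let g = (LEAST i. \<kappa> i \<le> m) in (g, \<lambda>i. \<kappa> (i + g))) = \<kappa>"
      by (simp only: Let_def g_def case_prod_conv)
  qed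
  show "(\<lambda>(g, \<kappa>) i. if i < g then Suc m else \<kappa> (i - g)) ` (UNIV \<times> {\<kappa> \<in> partitions. \<kappa> 0 \<le> m})
      \<subseteq> {\<kappa> \<in> partitions. \<kappa> 0 \<le> Suc m}"
  proof clarify
    fix g :: nat and \<kappa> :: "nat \<Rightarrow> nat" assume k: "\<kappa> \<in> partitions" "\<kappa> 0 \<le> m"
    obtain n where n: "\<And>i. n \<le> i \<Longrightarrow> \<kappa> i = 0" using k(1) partitions_eventually_zero by blast
    have "(\<lambda>i. if i < g then Suc m else \<kappa> (i - g)) \<in> partitions"
    proof (rule partitionsI[where n = "g + n"])
      fix i
      show "(if Suc i < g then Suc m else \<kappa> (Suc i - g)) \<le> (if i < g then Suc m else \<kappa> (i - g))"
        using k(2) partitions_antimono[OF k(1), of "i - g" "Suc i - g"]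
          partitions_antimono[OF k(1), of 0 "Suc i - g"] by auto
    qed (use n in auto)
    then show "(\<lambda>i. if i < g then Suc m else \<kappa> (i - g)) \<in> partitions \<and>
        (if 0 < g then Suc m else \<kappa> (0 - g)) \<le> Suc m"
      using k(2) by auto
  qed
  show "(\<lambda>\<kappa>. let g = (LEAST i. \<kappa> i \<le> m) in (g, \<lambda>i. \<kappa> (i + g))) ` {\<kappa> \<in> partitions. \<kappa> 0 \<le> Suc m}
      \<subseteq> UNIV \<times> {\<kappa> \<in> partitions. \<kappa> 0 \<le> m}"
  proof (rule image_subsetI)
    fix \<kappa> assume k: "\<kappa> \<in> {\<kappa> \<in> partitions. \<kappa> 0 \<le> Suc m}"
    let ?g = "LEAST i. \<kappa> i \<le> m"
    obtain n where n: "\<And>i. n \<le> i \<Longrightarrow> \<kappa> i = 0" using k partitions_eventually_zero by blast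
    have "(\<lambda>i. \<kappa> (i + ?g)) \<in> partitions"
      using k partitions_antimono by (intro partitionsI[where n = n]) (auto simp: n)
    then show "(let g = ?g in (g, \<lambda>i. \<kappa> (i + g))) \<in> UNIV \<times> {\<kappa> \<in> partitions. \<kappa> 0 \<le> m}"
      using least[of \<kappa>] k by (simp add: Let_def)
  qed
qed

lemma nn_integral_partitions_bounded:
  fixes u :: real
  assumes "0 \<le> u" "u < 1"
  shows "(\<integral>\<^sup>+\<kappa>. ennreal (u ^ psize \<kappa>) \<partial>count_space {\<kappa> \<in> partitions. \<kappa> 0 \<le> m}) =
    ennreal (\<Prod>i<m. 1 / (1 - u * u ^ i))"
proof (induction m)
  case 0
  have "{\<kappa> \<in> partitions. \<kappa> 0 \<le> 0} = {\<lambda>_. 0}"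
    using partitions_antimono[of _ 0] by (fastforce simp: partitions_def antimono_def)
  then show ?case by (simp add: nn_integral_count_space_finite psize_def)
next
  case (Suc m)
  let ?v = "u * u ^ m"
  have v: "0 \<le> ?v" "?v < 1"
    using assms power_Suc_less_one[of u m] by (auto simp: less_le zero_less_mult_iff) (cases "u = 0"; auto)+
  have cP: "countable {\<kappa> \<in> partitions. \<kappa> 0 \<le> m}"
    by (rule countable_subset[OF _ countable_partitions]) auto
  have "(\<integral>\<^sup>+\<kappa>. ennreal (u ^ psize \<kappa>) \<partial>count_space {\<kappa> \<in> partitions. \<kappa> 0 \<le> Suc m}) =
    (\<integral>\<^sup>+x. ennreal (u ^ psize (\<lambda>i. if i < fst x then Suc m else snd x (i - fst x)))
        \<partial>count_space (UNIV \<times> {\<kappa> \<in> partitions. \<kappa> 0 \<le> m}))"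
    by (subst nn_integral_bij_count_space[OF bij_betw_partitions_Suc, symmetric]) (simp add: case_prod_unfold)
  also have "\<dots> = (\<integral>\<^sup>+g. \<integral>\<^sup>+\<kappa>. ennreal (u ^ psize (\<lambda>i. if i < g then Suc m else \<kappa> (i - g)))
      \<partial>count_space {\<kappa> \<in> partitions. \<kappa> 0 \<le> m} \<partial>count_space UNIV)"
    by (subst nn_integral_count_space_prod[OF _ cP]) (simp_all cong: if_cong)
  also have "\<dots> = (\<integral>\<^sup>+g. \<integral>\<^sup>+\<kappa>. ennreal (?v ^ g) * ennreal (u ^ psize \<kappa>)
      \<partial>count_space {\<kappa> \<in> partitions. \<kappa> 0 \<le> m} \<partial>count_space UNIV)"
  proof (intro nn_integral_cong)
    fix g \<kappa> assume "\<kappa> \<in> space (count_space {\<kappa> \<in> partitions. \<kappa> 0 \<le> m})"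
    then have "u ^ psize (\<lambda>i. if i < g then Suc m else \<kappa> (i - g)) = ?v ^ g * u ^ psize \<kappa>"
      by (simp only: psize_shift power_add power_mult power_Suc space_count_space mem_Collect_eq)
    then show "ennreal (u ^ psize (\<lambda>i. if i < g then Suc m else \<kappa> (i - g))) =
        ennreal (?v ^ g) * ennreal (u ^ psize \<kappa>)"
      using v assms by (simp only: ennreal_mult zero_le_power)
  qed
  also have "\<dots> = (\<integral>\<^sup>+g. ennreal (?v ^ g) * ennreal (\<Prod>i<m. 1 / (1 - u * u ^ i)) \<partial>count_space UNIV)"
    by (simp add: nn_integral_cmult Suc.IH)
  also have "\<dots> = (\<Sum>g. ennreal (?v ^ g)) * ennreal (\<Prod>i<m. 1 / (1 - u * u ^ i))"
    by (subst nn_integral_multc) (simp_all add: nn_integral_count_space_nat)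
  also have "(\<Sum>g. ennreal (?v ^ g)) = ennreal (1 / (1 - ?v))"
    using v by (subst suminf_ennreal2) (auto simp: suminf_geometric summable_geometric)
  finally show ?case
    using v by (simp add: ennreal_mult'[symmetric] mult.commute)
qed

text \<open>Turns the normalized generating function of the partitions with
  \<open>\<kappa> 0 \<le> m\<close> into the prescribed distribution function of
  \<open>\<chi>\<close>.\<close>

lemma qpoch_quotient:
  fixes u :: real
  assumes "0 < u" "u < 1"
  shows "(\<Prod>i<m. 1 - u * u ^ i) > 0" "qpoch u u / (\<Prod>i<m. 1 - u * u ^ i) = qpoch (u ^ (m + 1)) u"
proof -
  show pos: "(\<Prod>i<m. 1 - u * u ^ i) > 0"
  proof (rule prod_pos)
    fix i show "0 < 1 - u * u ^ i" using assms power_Suc_less_one[of u i] by simp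
  qed
  define P where "P = (\<Prod>i<m. 1 - u * u ^ i)"
  have "qpoch u u = P * qpoch (u * u ^ m) u"
    unfolding P_def using assms by (intro qpoch_split) auto
  then show "qpoch u u / (\<Prod>i<m. 1 - u * u ^ i) = qpoch (u ^ (m + 1)) u"
    using pos unfolding P_def[symmetric] by simp
qed

section \<open>The law of a random partition\<close>

lemma emeasure_partition_law_le:
  fixes u :: real
  assumes "0 < u" "u < 1"
  shows "emeasure (partition_law u) {\<kappa> \<in> partitions. \<kappa> 0 \<le> m} = ennreal (qpoch (u ^ (m + 1)) u)"
proof -
  note prod = qpoch_quotient(1)[OF assms, of m]
  have "emeasure (partition_law u) {\<kappa> \<in> partitions. \<kappa> 0 \<le> m} =
    (\<integral>\<^sup>+\<kappa>. ennreal (qpoch u u) * ennreal (u ^ psize \<kappa>) * indicator {\<kappa> \<in> partitions. \<kappa> 0 \<le> m} \<kappa>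
      \<partial>count_space partitions)"
    unfolding partition_law_def point_measure_def using assms qpoch_LIMSEQ(2)[of u u]
    by (subst emeasure_density) (auto simp: ennreal_mult)
  also have "\<dots> = (\<integral>\<^sup>+\<kappa>. ennreal (qpoch u u) * ennreal (u ^ psize \<kappa>)
      \<partial>count_space {\<kappa> \<in> partitions. \<kappa> 0 \<le> m})"
    by (subst nn_integral_count_space_indicator, simp, subst (2) nn_integral_count_space_indicator)
       (auto intro!: nn_integral_cong simp: indicator_def)
  also have "\<dots> = ennreal (qpoch u u) * ennreal (\<Prod>i<m. 1 / (1 - u * u ^ i))"
    using assms by (subst nn_integral_cmult) (simp_all add: nn_integral_partitions_bounded)
  also have "\<dots> = ennreal (qpoch u u / (\<Prod>i<m. 1 - u * u ^ i))"
    using assms prod qpoch_LIMSEQ(2)[of u u]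
    by (subst ennreal_mult[symmetric]) (auto simp: prod_dividef)
  also have "qpoch u u / (\<Prod>i<m. 1 - u * u ^ i) = qpoch (u ^ (m + 1)) u"
    by (rule qpoch_quotient(2)[OF assms])
  finally show ?thesis .
qed

text \<open>Continuity along the events \<open>\<kappa> 0 \<le> m\<close>: the infinite product
  divided by its partial products tends to 1.\<close>

lemma emeasure_partition_law_space:
  fixes u :: real
  assumes "0 < u" "u < 1"
  shows "emeasure (partition_law u) partitions = 1"
proof -
  have "(\<lambda>m. emeasure (partition_law u) {\<kappa> \<in> partitions. \<kappa> 0 \<le> m})
      \<longlonglongrightarrow> emeasure (partition_law u) (\<Union>m. {\<kappa> \<in> partitions. \<kappa> 0 \<le> m})"
    by (intro Lim_emeasure_incseq) (auto simp: partition_law_def sets_point_measure incseq_def)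
  also have "(\<Union>m. {\<kappa> \<in> partitions. \<kappa> 0 \<le> m}) = partitions" by auto
  finally have *: "(\<lambda>m. ennreal (qpoch (u ^ (m + 1)) u)) \<longlonglongrightarrow> emeasure (partition_law u) partitions"
    using assms by (simp add: emeasure_partition_law_le)
  have "(\<lambda>m. \<Prod>i<m. 1 - u * u ^ i) \<longlonglongrightarrow> qpoch u u" using assms by (intro qpoch_LIMSEQ) auto
  then have "(\<lambda>m. qpoch u u / (\<Prod>i<m. 1 - u * u ^ i)) \<longlonglongrightarrow> qpoch u u / qpoch u u"
    using assms qpoch_LIMSEQ(2)[of u u] by (intro tendsto_divide tendsto_const) auto
  then have "(\<lambda>m. qpoch (u ^ (m + 1)) u) \<longlonglongrightarrow> 1"
    using assms qpoch_LIMSEQ(2)[of u u] unfolding qpoch_quotient(2)[OF assms] by simp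
  then have "(\<lambda>m. ennreal (qpoch (u ^ (m + 1)) u)) \<longlonglongrightarrow> ennreal 1"
    by (rule tendsto_ennrealI)
  with * show ?thesis using LIMSEQ_unique by fastforce
qed

lemma nn_integral_partition_law:
  assumes "0 < u" "u < 1"
  shows "(\<integral>\<^sup>+\<kappa>. f \<kappa> \<partial>partition_law u) =
    ennreal (qpoch u u) * (\<integral>\<^sup>+\<kappa>. ennreal (u ^ psize \<kappa>) * f \<kappa> \<partial>count_space partitions)"
  unfolding partition_law_def point_measure_def using assms qpoch_LIMSEQ(2)[of u u]
  by (subst nn_integral_density) (auto simp: ennreal_mult mult.assoc nn_integral_cmult)

text \<open>Summability is read off from total mass 1. It is needed for \<open>u = sqrt q\<close> in
  the dominating function.\<close>

lemma nn_integral_partitions_finite: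
  fixes u :: real
  assumes "0 < u" "u < 1"
  shows "(\<integral>\<^sup>+\<kappa>. ennreal (u ^ psize \<kappa>) \<partial>count_space partitions) < \<infinity>"
proof (rule ccontr)
  assume "\<not> ?thesis"
  then have "(\<integral>\<^sup>+\<kappa>. ennreal (u ^ psize \<kappa>) \<partial>count_space partitions) = \<infinity>"
    by (simp add: less_top[symmetric])
  moreover have "ennreal (qpoch u u) \<noteq> 0" using qpoch_LIMSEQ(2)[of u u] assms by simp
  ultimately have "(\<integral>\<^sup>+\<kappa>. 1 \<partial>partition_law u) = \<infinity>"
    using nn_integral_partition_law[OF assms, of "\<lambda>_. 1"] by (simp add: ennreal_mult_top)
  moreover have "space (partition_law u) = partitions"
    by (simp add: partition_law_def space_point_measure)
  ultimately show False using emeasure_partition_law_space[OF assms] by simp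
qed

section \<open>The limit of infinitely many removed slices\<close>

text \<open>Peaks and valleys of the zigzag profile at the levels \<open>N + 2 * j\<close>, whose
  parity is that of \<open>N\<close>.\<close>

definition peaks :: "nat \<Rightarrow> int set" where
  "peaks N = {h \<in> cyc N. even (h + int N)}"

definition valleys :: "nat \<Rightarrow> int set" where
  "valleys N = {h \<in> cyc N. odd (h + int N)}"

definition peak_size :: "nat \<Rightarrow> (int \<Rightarrow> nat \<Rightarrow> nat) \<Rightarrow> nat" where
  "peak_size N \<Lambda> = (\<Sum>h\<in>peaks N. psize (\<Lambda> h))"

definition valley_size :: "nat \<Rightarrow> (int \<Rightarrow> nat \<Rightarrow> nat) \<Rightarrow> nat" where
  "valley_size N \<Lambda> = (\<Sum>h\<in>valleys N. psize (\<Lambda> h))"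

lemma cyc_peaks_valleys: "cyc N = peaks N \<union> valleys N" "peaks N \<inter> valleys N = {}"
  "finite (peaks N)" "finite (valleys N)"
  by (auto simp: peaks_def valleys_def)

lemma card_peaks: "1 \<le> N \<Longrightarrow> card (peaks N) = N"
proof -
  assume N: "1 \<le> N"
  have "peaks N = slice N (Suc N)"
    unfolding slice_Suc[OF N] peaks_def using pos_bounds(2)[of N] by auto
  then show ?thesis using card_slice[OF N, of N] by simp
qed

lemma valleys_nbr:
  assumes "1 \<le> N" "h \<in> valleys N"
  shows "rt N h \<in> peaks N" "lt N h \<in> peaks N"
  using assms by (auto simp: peaks_def valleys_def)

lemma sum_valleys_nbr:
  assumes "1 \<le> N"
  shows "(\<Sum>h\<in>valleys N. f (rt N h)) = (\<Sum>h\<in>peaks N. f h)"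
    and "(\<Sum>h\<in>valleys N. f (lt N h)) = (\<Sum>h\<in>peaks N. f h)"
proof -
  show "(\<Sum>h\<in>valleys N. f (rt N h)) = (\<Sum>h\<in>peaks N. f h)"
    by (rule sum.reindex_bij_witness[where i = "lt N" and j = "rt N"])
       (use assms in \<open>auto simp: peaks_def valleys_def\<close>)
  show "(\<Sum>h\<in>valleys N. f (lt N h)) = (\<Sum>h\<in>peaks N. f h)"
    by (rule sum.reindex_bij_witness[where i = "rt N" and j = "lt N"])
       (use assms in \<open>auto simp: peaks_def valleys_def\<close>)
qed

lemma configs_valley:
  assumes "1 \<le> N" "\<Lambda> \<in> configs N (valleys N)" "h \<in> valleys N"
  shows "\<Lambda> h \<prec> \<Lambda> (rt N h)" "\<Lambda> h \<prec> \<Lambda> (lt N h)"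
proof -
  have h: "h \<in> cyc N" using assms(3) by (simp add: valleys_def)
  show "\<Lambda> h \<prec> \<Lambda> (rt N h)" using assms h by (auto simp: configs_def)
  have "lt N h \<notin> valleys N" using valleys_nbr[OF assms(1,3)] cyc_peaks_valleys(2) by blast
  moreover have "lt N h \<in> cyc N" using assms(1) by simp
  ultimately have "\<Lambda> (rt N (lt N h)) \<prec> \<Lambda> (lt N h)"
    using assms(2) unfolding configs_def by fastforce
  then show "\<Lambda> h \<prec> \<Lambda> (lt N h)" using h by simp
qed

lemma configs_valley_psize:
  assumes "1 \<le> N" "\<Lambda> \<in> configs N (valleys N)" "h \<in> valleys N"
  shows "psize (\<Lambda> h) \<le> psize (\<Lambda> (rt N h))" "psize (\<Lambda> h) \<le> psize (\<Lambda> (lt N h))"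
  using configs_valley[OF assms] configs_partition[OF assms(2)] assms
  by (auto intro!: interlaces_psize simp: valleys_def)

lemma valley_size_le: "1 \<le> N \<Longrightarrow> \<Lambda> \<in> configs N (valleys N) \<Longrightarrow> valley_size N \<Lambda> \<le> peak_size N \<Lambda>"
  unfolding peak_size_def valley_size_def sum_valleys_nbr(1)[where f = "\<lambda>h. psize (\<Lambda> h)", symmetric]
  by (intro sum_mono configs_valley_psize)

text \<open>The sizes of the right neighbours of all valleys add up to the peak size, and likewise
  on the left. Equal totals thus force equal sizes termwise, interlacing then forces equal
  partitions, and equality spreads around the cycle.\<close>

lemma configs_balanced_constant:
  assumes N: "1 \<le> N" and L: "\<Lambda> \<in> configs N (valleys N)" and eq: "valley_size N \<Lambda> = peak_size N \<Lambda>"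
    and h: "h \<in> cyc N"
  shows "\<Lambda> h = \<Lambda> 0"
proof -
  have v: "\<Lambda> k = \<Lambda> (rt N k)" "\<Lambda> k = \<Lambda> (lt N k)" if k: "k \<in> valleys N" for k
  proof -
    have kc: "k \<in> cyc N" using k by (simp add: valleys_def)
    have "psize (\<Lambda> k) = psize (\<Lambda> (rt N k))"
      by (rule sum_mono_inv[OF _ configs_valley_psize(1)[OF N L] k cyc_peaks_valleys(4)])
         (use eq in \<open>simp_all add: valley_size_def peak_size_def sum_valleys_nbr(1)[OF N, of "\<lambda>h. psize (\<Lambda> h)"]\<close>)
    then show "\<Lambda> k = \<Lambda> (rt N k)"
      using configs_valley(1)[OF N L k] configs_partition[OF L] N kc
      by (intro psize_mono_eq) (auto simp: interlaces_def)
    have "psize (\<Lambda> k) = psize (\<Lambda> (lt N k))"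
      by (rule sum_mono_inv[OF _ configs_valley_psize(2)[OF N L] k cyc_peaks_valleys(4)])
         (use eq in \<open>simp_all add: valley_size_def peak_size_def sum_valleys_nbr(2)[OF N, of "\<lambda>h. psize (\<Lambda> h)"]\<close>)
    then show "\<Lambda> k = \<Lambda> (lt N k)"
      using configs_valley(2)[OF N L k] configs_partition[OF L] N kc
      by (intro psize_mono_eq) (auto simp: interlaces_def)
  qed
  have step: "\<Lambda> (rt N k) = \<Lambda> k" if k: "k \<in> cyc N" for k
  proof (cases "k \<in> valleys N")
    case False
    then have "rt N k \<in> valleys N" using k N by (auto simp: valleys_def)
    from v(2)[OF this] show ?thesis using k by simp
  qed (simp add: v(1)[symmetric])
  have "\<Lambda> (int i) = \<Lambda> 0" if "i < 2 * N" for i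
    using that
  proof (induction i)
    case (Suc i)
    then have "int i \<in> cyc N" "rt N (int i) = int (Suc i)" by (auto simp: cyc_def rt_def)
    with step[of "int i"] Suc show ?case by simp
  qed simp
  from this[of "nat h"] show ?thesis using h by (auto simp: cyc_def)
qed

definition const_config :: "nat \<Rightarrow> (nat \<Rightarrow> nat) \<Rightarrow> int \<Rightarrow> nat \<Rightarrow> nat" where
  "const_config N \<kappa> = (\<lambda>h\<in>cyc N. \<kappa>)"

lemma const_config_in_configs: "1 \<le> N \<Longrightarrow> \<kappa> \<in> partitions \<Longrightarrow> const_config N \<kappa> \<in> configs N D"
  by (auto simp: const_config_def configs_def interlaces_refl)

lemma const_config_0 [simp]: "1 \<le> N \<Longrightarrow> const_config N \<kappa> 0 = \<kappa>"
  by (simp add: const_config_def cyc_def)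

lemma const_config_size:
  assumes "1 \<le> N"
  shows "peak_size N (const_config N \<kappa>) = N * psize \<kappa>"
    and "valley_size N (const_config N \<kappa>) = peak_size N (const_config N \<kappa>)"
proof -
  have "psize (const_config N \<kappa> h) = psize \<kappa>" if "h \<in> cyc N" for h
    using that by (simp add: const_config_def)
  then have p: "peak_size N (const_config N \<kappa>) = (\<Sum>h\<in>peaks N. psize \<kappa>)"
    and v: "valley_size N (const_config N \<kappa>) = (\<Sum>h\<in>valleys N. psize \<kappa>)"
    unfolding peak_size_def valley_size_def
    by (auto intro!: sum.cong simp: peaks_def valleys_def)
  show "peak_size N (const_config N \<kappa>) = N * psize \<kappa>" using card_peaks[OF assms] p by simp
  show "valley_size N (const_config N \<kappa>) = peak_size N (const_config N \<kappa>)"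
    using p v sum_valleys_nbr(1)[OF assms, of "\<lambda>_. psize \<kappa>"] by simp
qed

lemma configs_balanced_iff:
  assumes "1 \<le> N" "\<Lambda> \<in> configs N (valleys N)"
  shows "valley_size N \<Lambda> = peak_size N \<Lambda> \<longleftrightarrow> \<Lambda> \<in> const_config N ` partitions"
proof
  assume eq: "valley_size N \<Lambda> = peak_size N \<Lambda>"
  have 0: "0 \<in> cyc N" using assms(1) by (simp add: cyc_def)
  have "\<Lambda> = const_config N (\<Lambda> 0)"
  proof
    fix h
    show "\<Lambda> h = const_config N (\<Lambda> 0) h"
      using configs_balanced_constant[OF assms eq, of h] assms(2)
      by (cases "h \<in> cyc N") (auto simp: const_config_def configs_def PiE_iff extensional_def)
  qed
  then show "\<Lambda> \<in> const_config N ` partitions" using configs_partition[OF assms(2) 0] by blast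
qed (use const_config_size(2)[OF assms(1)] in auto)

context cylindric_lpp
begin

lemma time_zigzag:
  assumes "h \<in> cyc N"
  shows "time N (N + 2 * j) {} h = int (N + 2 * j) + (if h \<in> peaks N then 0 else 1)"
  using pos_bounds(2)[of N h] assms by (auto simp: time_def peaks_def)

lemma nbr_peaks: "h \<in> cyc N \<Longrightarrow> lt N h \<in> peaks N \<longleftrightarrow> h \<notin> peaks N" "h \<in> cyc N \<Longrightarrow> rt N h \<in> peaks N \<longleftrightarrow> h \<notin> peaks N"
  using N by (auto simp: peaks_def)

text \<open>Advancing two levels at a time keeps the set of configurations fixed, so the limit is
  taken over one index set.\<close>

lemma up_steps_zigzag: "up_steps N (time N (N + 2 * j) {}) = valleys N"
proof -
  have "h \<in> cyc N \<and> time N (N + 2 * j) {} (rt N h) < time N (N + 2 * j) {} h \<longleftrightarrow> h \<in> valleys N" for h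
  proof (cases "h \<in> cyc N")
    case True
    then show ?thesis
      using N by (cases "h \<in> peaks N") (simp_all add: time_zigzag nbr_peaks, simp_all add: peaks_def valleys_def)
  qed (simp add: valleys_def)
  then show ?thesis by (simp add: up_steps_def)
qed

text \<open>With \<open>x = a * q ^ (N + 2 * j)\<close> a peak weighs \<open>q * x\<close> and a
  valley \<open>inverse x\<close>. The level enters only through the excess of peak size over valley
  size, which decides what survives in the limit.\<close>

lemma weight_zigzag:
  assumes "\<Lambda> \<in> configs N (valleys N)"
  shows "weight N (profile_weight N a q (time N (N + 2 * j) {})) \<Lambda> =
    q ^ peak_size N \<Lambda> * (a * q ^ (N + 2 * j)) ^ (peak_size N \<Lambda> - valley_size N \<Lambda>)"
proof -
  let ?n = "N + 2 * j"
  let ?c = "profile_weight N a q (time N ?n {})" and ?x = "a * q ^ ?n"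
  have x: "?x \<noteq> 0" using a q by simp
  have p: "?c h = q * ?x" if "h \<in> peaks N" for h
  proof -
    have h: "h \<in> cyc N" using that by (simp add: peaks_def)
    then have "lt N h \<notin> peaks N" "rt N h \<notin> peaks N" using that by (simp_all add: nbr_peaks)
    then show ?thesis
      using h that N by (simp add: profile_weight_def time_zigzag del: of_nat_add)
  qed
  have v: "?c h = inverse ?x" if "h \<in> valleys N" for h
  proof -
    have h: "h \<in> cyc N" "h \<notin> peaks N" using that by (auto simp: peaks_def valleys_def)
    then have "lt N h \<in> peaks N" "rt N h \<in> peaks N" by (simp_all add: nbr_peaks)
    moreover have "nat (int ?n + 1) = Suc ?n" by simp
    ultimately have "?c h = q / (a * q ^ Suc ?n)"
      using h N by (simp add: profile_weight_def time_zigzag del: of_nat_add power_Suc)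
    then show ?thesis using a q by (simp add: inverse_eq_divide)
  qed
  have "weight N ?c \<Lambda> = (\<Prod>h\<in>peaks N. (q * ?x) ^ psize (\<Lambda> h)) * (\<Prod>h\<in>valleys N. inverse ?x ^ psize (\<Lambda> h))"
    unfolding weight_def cyc_peaks_valleys(1)
    by (subst prod.union_disjoint) (simp_all add: cyc_peaks_valleys p v)
  also have "\<dots> = (q * ?x) ^ peak_size N \<Lambda> * inverse ?x ^ valley_size N \<Lambda>"
    by (simp only: power_sum peak_size_def valley_size_def)
  also have "\<dots> = q ^ peak_size N \<Lambda> * (?x ^ peak_size N \<Lambda> / ?x ^ valley_size N \<Lambda>)"
    by (simp only: power_mult_distrib power_inverse divide_inverse mult.assoc)
  also have "?x ^ peak_size N \<Lambda> / ?x ^ valley_size N \<Lambda> = ?x ^ (peak_size N \<Lambda> - valley_size N \<Lambda>)"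
    by (rule power_diff[OF x valley_size_le[OF N assms], symmetric])
  finally show ?thesis .
qed

lemma weight_zigzag_le:
  assumes "\<Lambda> \<in> configs N (valleys N)"
  shows "weight N (profile_weight N a q (time N (N + 2 * j) {})) \<Lambda> \<le> (\<Prod>h\<in>cyc N. sqrt q ^ psize (\<Lambda> h))"
proof -
  have "weight N (profile_weight N a q (time N (N + 2 * j) {})) \<Lambda> \<le> q ^ peak_size N \<Lambda> * 1"
    unfolding weight_zigzag[OF assms] using a q aq_bounds[of "N + 2 * j"]
    by (intro mult_left_mono power_le_one) auto
  \<comment> \<open>Doubling the exponent frees one copy of the peak size, which bounds the valley
    size.\<close>
  also have "\<dots> = sqrt q ^ (2 * peak_size N \<Lambda>)" using q by (simp add: power_mult)
  also have "\<dots> \<le> sqrt q ^ (peak_size N \<Lambda> + valley_size N \<Lambda>)"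
    using q valley_size_le[OF N assms] by (intro power_decreasing) auto
  also have "peak_size N \<Lambda> + valley_size N \<Lambda> = (\<Sum>h\<in>cyc N. psize (\<Lambda> h))"
    unfolding cyc_peaks_valleys(1) peak_size_def valley_size_def
    by (rule sum.union_disjoint[symmetric]) (simp_all add: cyc_peaks_valleys)
  finally show ?thesis by (simp only: power_sum)
qed

text \<open>Without the interlacing conditions the sum factors over the positions of the
  cycle.\<close>

lemma nn_integral_weight_bound_finite:
  "(\<integral>\<^sup>+\<Lambda>. ennreal (\<Prod>h\<in>cyc N. sqrt q ^ psize (\<Lambda> h)) \<partial>count_space (configs N D)) < \<infinity>"
proof -
  let ?P = "cyc N \<rightarrow>\<^sub>E partitions"
  have PiM: "PiM (cyc N) (\<lambda>_. count_space partitions) = count_space ?P"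
    by (intro count_space_PiM_finite) (auto simp: countable_partitions)
  interpret product_sigma_finite "\<lambda>_::int. count_space partitions"
    by (intro product_sigma_finite.intro sigma_finite_measure_count_space_countable countable_partitions)
  have "(\<integral>\<^sup>+\<Lambda>. ennreal (\<Prod>h\<in>cyc N. sqrt q ^ psize (\<Lambda> h)) \<partial>count_space (configs N D)) \<le>
      (\<integral>\<^sup>+\<Lambda>. ennreal (\<Prod>h\<in>cyc N. sqrt q ^ psize (\<Lambda> h)) \<partial>count_space ?P)"
    by (subst (1 2) nn_integral_count_space_indicator)
       (auto intro!: nn_integral_mono simp: indicator_def configs_def)
  also have "\<dots> = (\<integral>\<^sup>+\<Lambda>. (\<Prod>h\<in>cyc N. ennreal (sqrt q ^ psize (\<Lambda> h))) \<partial>count_space ?P)"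
    using q by (simp add: prod_ennreal)
  also have "\<dots> = (\<Prod>h\<in>cyc N. \<integral>\<^sup>+\<kappa>. ennreal (sqrt q ^ psize \<kappa>) \<partial>count_space partitions)"
    unfolding PiM[symmetric] by (rule product_nn_integral_prod) auto
  also have "\<dots> < \<infinity>"
    using nn_integral_partitions_finite[of "sqrt q"] q
    by (simp add: less_top[symmetric] ennreal_prod_eq_top power_eq_top_ennreal)
  finally show ?thesis .
qed

definition passage_le :: "nat \<Rightarrow> enat \<Rightarrow> 'a set" where
  "passage_le c m = {\<omega> \<in> space M. last_passage_time N (\<lambda>s. w s \<omega>) + enat c \<le> m}"

lemma lpp_event_const:
  "lpp_event n {} m (\<lambda>h. const_config N \<kappa> h 0) = {\<omega> \<in> space M. lpp_le N (\<lambda>s. w s \<omega>) n (\<lambda>_. \<kappa> 0) m}"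
proof -
  have "lpp_le N v n (\<lambda>h. const_config N \<kappa> h 0) m = lpp_le N v n (\<lambda>_. \<kappa> 0) m" for v
    by (rule lpp_le_cong[OF N]) (auto simp: const_config_def)
  then show ?thesis by (simp add: lpp_event_def)
qed

lemma passage_le_eq: "passage_le c m = (\<Inter>n. {\<omega> \<in> space M. lpp_le N (\<lambda>s. w s \<omega>) n (\<lambda>_. c) m})"
  by (auto simp: passage_le_def last_passage_time_le_iff)

lemma lpp_le_const_measurable: "{\<omega> \<in> space M. lpp_le N (\<lambda>s. w s \<omega>) n (\<lambda>_. c) m} \<in> events"
  using lpp_event_measurable[of "{}" n m "\<lambda>_. c"]
  by (simp add: lpp_event_def)

text \<open>For constant boundary values a deeper level only adds conditions, so continuity from
  above applies.\<close>

lemma lpp_event_const_LIMSEQ: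
  "(\<lambda>j. emeasure M (lpp_event (N + 2 * j) {} m (\<lambda>h. const_config N \<kappa> h 0)))
     \<longlonglongrightarrow> emeasure M (passage_le (\<kappa> 0) m)"
proof -
  let ?B = "\<lambda>n. {\<omega> \<in> space M. lpp_le N (\<lambda>s. w s \<omega>) n (\<lambda>_. \<kappa> 0) m}"
  have "lpp_le N v n (\<lambda>_. \<kappa> 0) m" if le: "lpp_le N v (Suc n) (\<lambda>_. \<kappa> 0) m" for v n
    unfolding lpp_le_def
  proof
    fix p assume "p \<in> paths N"
    then have "enat ((\<Sum>j\<in>{1..Suc n}. v (p j, j)) + \<kappa> 0) \<le> m" using le by (simp add: lpp_le_def)
    moreover have "enat ((\<Sum>j\<in>{1..n}. v (p j, j)) + \<kappa> 0) \<le> enat ((\<Sum>j\<in>{1..Suc n}. v (p j, j)) + \<kappa> 0)"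
      by simp
    ultimately show "enat ((\<Sum>j\<in>{1..n}. v (p j, j)) + \<kappa> 0) \<le> m" by (rule order.trans[rotated])
  qed
  then have "decseq ?B" by (intro decseq_SucI) auto
  then have "(\<lambda>n. emeasure M (?B n)) \<longlonglongrightarrow> emeasure M (\<Inter>n. ?B n)"
    using lpp_le_const_measurable by (intro Lim_emeasure_decseq) auto
  from LIMSEQ_subseq_LIMSEQ[OF this, of "\<lambda>j. N + 2 * j"]
  show ?thesis by (simp add: lpp_event_const passage_le_eq o_def strict_mono_def)
qed

lemma partition_fun_zigzag_LIMSEQ:
  "(\<lambda>j. partition_fun (N + 2 * j) {} m) \<longlonglongrightarrow>
    (\<integral>\<^sup>+\<kappa>. ennreal ((q ^ N) ^ psize \<kappa>) * emeasure M (passage_le (\<kappa> 0) m) \<partial>count_space partitions)"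
proof -
  let ?C = "configs N (valleys N)"
  let ?W = "\<lambda>j. weight N (profile_weight N a q (time N (N + 2 * j) {}))"
  let ?E = "\<lambda>j \<Lambda>. emeasure M (lpp_event (N + 2 * j) {} m (\<lambda>h. \<Lambda> h 0))"
  let ?f = "\<lambda>\<Lambda>. ennreal ((q ^ N) ^ psize (\<Lambda> 0)) * emeasure M (passage_le (\<Lambda> 0 0) m)"
  let ?g = "\<lambda>\<Lambda>. if \<Lambda> \<in> const_config N ` partitions then ?f \<Lambda> else 0"
  have lim: "(\<lambda>j. ennreal (?W j \<Lambda>) * ?E j \<Lambda>) \<longlonglongrightarrow> ?g \<Lambda>" if L: "\<Lambda> \<in> ?C" for \<Lambda>
  proof (cases "\<Lambda> \<in> const_config N ` partitions")
    case True
    then obtain \<kappa> where k: "\<kappa> \<in> partitions" "\<Lambda> = const_config N \<kappa>" by blast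
    \<comment> \<open>A constant configuration has no excess, so its weight does not depend on
      \<open>j\<close> and only the event varies.\<close>
    have "?W j \<Lambda> = (q ^ N) ^ psize \<kappa>" for j
      using weight_zigzag[OF L, of j] const_config_size[OF N, of \<kappa>] by (simp add: k(2) power_mult)
    moreover have "(\<lambda>j. ennreal ((q ^ N) ^ psize \<kappa>) * ?E j \<Lambda>) \<longlonglongrightarrow>
        ennreal ((q ^ N) ^ psize \<kappa>) * emeasure M (passage_le (\<kappa> 0) m)"
      unfolding k(2) by (intro ennreal_tendsto_cmult lpp_event_const_LIMSEQ) simp
    ultimately show ?thesis using True N by (simp add: k(2))
  next
    case False
    \<comment> \<open>A positive excess makes the weight tend to 0, and the probabilities stay below
      1.\<close>
    then have d: "peak_size N \<Lambda> - valley_size N \<Lambda> > 0"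
      using configs_balanced_iff[OF N L] valley_size_le[OF N L] by simp
    have "(\<lambda>j. q ^ (N + 2 * j)) \<longlonglongrightarrow> 0"
      using LIMSEQ_subseq_LIMSEQ[OF LIMSEQ_power_zero[of q], of "\<lambda>j. N + 2 * j"] q
      by (simp add: o_def strict_mono_def)
    then have "(\<lambda>j. ?W j \<Lambda>) \<longlonglongrightarrow>
        q ^ peak_size N \<Lambda> * (a * 0) ^ (peak_size N \<Lambda> - valley_size N \<Lambda>)"
      unfolding weight_zigzag[OF L] by (intro tendsto_mult tendsto_const tendsto_power)
    then have W: "(\<lambda>j. ennreal (?W j \<Lambda>)) \<longlonglongrightarrow> 0"
      using d tendsto_ennrealI by (force simp: zero_power)
    have "(\<lambda>j. ennreal (?W j \<Lambda>) * ?E j \<Lambda>) \<longlonglongrightarrow> 0"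
    proof (rule tendsto_sandwich[OF _ _ tendsto_const W])
      show "\<forall>\<^sub>F j in sequentially. ennreal (?W j \<Lambda>) * ?E j \<Lambda> \<le> ennreal (?W j \<Lambda>)"
      proof (intro always_eventually allI)
        fix j
        have "ennreal (?W j \<Lambda>) * ?E j \<Lambda> \<le> ennreal (?W j \<Lambda>) * 1"
          by (intro mult_left_mono emeasure_le_1) simp
        then show "ennreal (?W j \<Lambda>) * ?E j \<Lambda> \<le> ennreal (?W j \<Lambda>)" by simp
      qed
    qed simp
    then show ?thesis using False by simp
  qed
  have "(\<lambda>j. \<integral>\<^sup>+\<Lambda>. ennreal (?W j \<Lambda>) * ?E j \<Lambda> \<partial>count_space ?C) \<longlonglongrightarrow>
      (\<integral>\<^sup>+\<Lambda>. ?g \<Lambda> \<partial>count_space ?C)"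
  proof (rule nn_integral_dominated_convergence[where w = "\<lambda>\<Lambda>. ennreal (\<Prod>h\<in>cyc N. sqrt q ^ psize (\<Lambda> h))"])
    fix j
    have "ennreal (?W j \<Lambda>) * ?E j \<Lambda> \<le> ennreal (\<Prod>h\<in>cyc N. sqrt q ^ psize (\<Lambda> h))" if "\<Lambda> \<in> ?C" for \<Lambda>
    proof -
      have "ennreal (?W j \<Lambda>) * ?E j \<Lambda> \<le> ennreal (?W j \<Lambda>) * 1"
        by (intro mult_left_mono emeasure_le_1) simp
      also have "\<dots> \<le> ennreal (\<Prod>h\<in>cyc N. sqrt q ^ psize (\<Lambda> h))"
        using weight_zigzag_le[OF that] by (simp add: ennreal_leI)
      finally show ?thesis .
    qed
    then show "AE \<Lambda> in count_space ?C. ennreal (?W j \<Lambda>) * ?E j \<Lambda> \<le> ennreal (\<Prod>h\<in>cyc N. sqrt q ^ psize (\<Lambda> h))"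
      by (simp add: AE_count_space)
  qed (use lim nn_integral_weight_bound_finite[of "valleys N"] in \<open>auto simp: AE_count_space\<close>)
  moreover have "(\<integral>\<^sup>+\<Lambda>. ?g \<Lambda> \<partial>count_space ?C) =
      (\<integral>\<^sup>+\<kappa>. ennreal ((q ^ N) ^ psize \<kappa>) * emeasure M (passage_le (\<kappa> 0) m) \<partial>count_space partitions)"
  proof -
    have "(\<integral>\<^sup>+\<Lambda>. ?g \<Lambda> \<partial>count_space ?C) = (\<integral>\<^sup>+\<Lambda>. ?g \<Lambda> \<partial>count_space (const_config N ` partitions))"
      by (rule nn_integral_count_space_eq) (use const_config_in_configs[OF N] in auto)
    also have "\<dots> = (\<integral>\<^sup>+\<Lambda>. ?f \<Lambda> \<partial>count_space (const_config N ` partitions))"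
      by (intro nn_integral_cong) simp
    also have "\<dots> = (\<integral>\<^sup>+\<kappa>. ?f (const_config N \<kappa>) \<partial>count_space partitions)"
    proof (rule nn_integral_bij_count_space[symmetric])
      show "bij_betw (const_config N) partitions (const_config N ` partitions)"
        by (intro bij_betw_imageI inj_onI refl) (metis const_config_0[OF N])
    qed
    finally show ?thesis using N by simp
  qed
  ultimately show ?thesis
    unfolding partition_fun_def up_steps_zigzag by simp
qed

lemma partition_fun_eq:
  "partition_fun 0 {} m =
    ennreal (cpp_Z N a q) * (\<integral>\<^sup>+\<kappa>. emeasure M (passage_le (\<kappa> 0) m) \<partial>partition_law (q ^ N))"
proof -
  have u: "0 < q ^ N" "q ^ N < 1" using q N by (auto simp: power_less_one_iff)
  let ?I = "\<integral>\<^sup>+\<kappa>. ennreal ((q ^ N) ^ psize \<kappa>) * emeasure M (passage_le (\<kappa> 0) m) \<partial>count_space partitions"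
  let ?K = "\<lambda>n. \<Prod>k=1..n. (1 / (1 - a * q ^ k)) ^ min k N"
  have Q: "qpoch (q ^ N) (q ^ N) > 0" using u by (intro qpoch_LIMSEQ(2)) auto
  have Z: "cpp_Z N a q > 0" by (rule cpp_Z_pos[OF N a q])
  have "(\<lambda>j. ?K (N + 2 * j)) \<longlonglongrightarrow> cpp_Z N a q * qpoch (q ^ N) (q ^ N)"
    using LIMSEQ_subseq_LIMSEQ[OF cpp_Z_LIMSEQ[OF N a q], of "\<lambda>j. N + 2 * j"]
    by (simp add: o_def strict_mono_def)
  then have "(\<lambda>j. ennreal (?K (N + 2 * j))) \<longlonglongrightarrow> ennreal (cpp_Z N a q * qpoch (q ^ N) (q ^ N))"
    by (rule tendsto_ennrealI)
  moreover note partition_fun_zigzag_LIMSEQ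
  ultimately have "(\<lambda>j. ennreal (?K (N + 2 * j)) * partition_fun (N + 2 * j) {} m) \<longlonglongrightarrow>
      ennreal (cpp_Z N a q * qpoch (q ^ N) (q ^ N)) * ?I"
    by (rule tendsto_mult_ennreal) (use Q Z in auto)
  \<comment> \<open>By \<open>partition_fun_0\<close> the product has the same value at every level,
    so the limit identifies it.\<close>
  then have "(\<lambda>j::nat. partition_fun 0 {} m) \<longlonglongrightarrow> ennreal (cpp_Z N a q * qpoch (q ^ N) (q ^ N)) * ?I"
    by (simp only: partition_fun_0[symmetric])
  then have "partition_fun 0 {} m = ennreal (cpp_Z N a q * qpoch (q ^ N) (q ^ N)) * ?I"
    by (rule LIMSEQ_unique[OF tendsto_const])
  then show ?thesis
    using nn_integral_partition_law[OF u] Z Q by (simp add: ennreal_mult mult.assoc)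
qed

end

section \<open>Cylindric plane partitions as configurations on the cycle\<close>

text \<open>Both ends \<open>- int N\<close> and \<open>int N\<close> read the same position of the
  cycle, which builds in the periodicity.\<close>

definition unroll :: "nat \<Rightarrow> (int \<Rightarrow> nat \<Rightarrow> nat) \<Rightarrow> int \<Rightarrow> nat \<Rightarrow> nat" where
  "unroll N \<Lambda> = (\<lambda>i\<in>{- int N..int N}. \<Lambda> (i mod (2 * int N)))"

text \<open>Chooses representatives from \<open>- int N\<close> to \<open>int N - 1\<close>, so
  position \<open>int N\<close> goes to \<open>- int N\<close>.\<close>

definition centred :: "nat \<Rightarrow> int \<Rightarrow> int" where
  "centred N h = (if h < int N then h else h - 2 * int N)"

lemma mod_cyc:
  assumes "1 \<le> N" "i \<in> {- int N..<int N}"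
  shows "i mod (2 * int N) = (if i < 0 then i + 2 * int N else i)"
proof (cases "i < 0")
  case True
  have "i mod (2 * int N) = (i + 2 * int N) mod (2 * int N)" by simp
  also have "\<dots> = i + 2 * int N" using assms True by (intro mod_pos_pos_trivial) auto
  finally show ?thesis using True by simp
qed (use assms in auto)

lemma centred_mod: "1 \<le> N \<Longrightarrow> i \<in> {- int N..<int N} \<Longrightarrow> centred N (i mod (2 * int N)) = i"
  by (subst mod_cyc) (auto simp: centred_def)

lemma mod_centred: "h \<in> cyc N \<Longrightarrow> centred N h mod (2 * int N) = h"
  by (auto simp: centred_def cyc_def mod_diff_right_eq[symmetric])

lemma centred_bounds: "h \<in> cyc N \<Longrightarrow> centred N h \<in> {- int N..<int N}"
  by (auto simp: centred_def cyc_def)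

lemma mod_in_cyc: "1 \<le> N \<Longrightarrow> i mod (2 * int N) \<in> cyc N"
  by (simp add: cyc_def)

lemma N_mod: "1 \<le> N \<Longrightarrow> int N mod (2 * int N) = int N" "1 \<le> N \<Longrightarrow> (- int N) mod (2 * int N) = int N"
  by (simp, subst mod_cyc, auto)

lemma up_steps_pos:
  assumes "1 \<le> N"
  shows "up_steps N (pos N) = {h \<in> cyc N. int N \<le> h}"
proof -
  have "pos N (rt N h) < pos N h \<longleftrightarrow> int N \<le> h" if "h \<in> cyc N" for h
    unfolding rt_eq[OF that] using assms that by (auto simp: pos_def cyc_def)
  then show ?thesis by (auto simp: up_steps_def)
qed

lemma bij_betw_unroll:
  assumes N: "1 \<le> N"
  shows "bij_betw (unroll N) (configs N (up_steps N (pos N))) (cylindric_plane_partitions N)"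
proof (rule bij_betw_byWitness[where f' = "\<lambda>\<Lambda>. \<lambda>h\<in>cyc N. \<Lambda> (centred N h)"])
  show "\<forall>\<Lambda>\<in>configs N (up_steps N (pos N)). (\<lambda>h\<in>cyc N. unroll N \<Lambda> (centred N h)) = \<Lambda>"
  proof
    fix \<Lambda> assume "\<Lambda> \<in> configs N (up_steps N (pos N))"
    then have "\<Lambda> \<in> extensional (cyc N)" by (auto simp: configs_def PiE_def)
    moreover have "unroll N \<Lambda> (centred N h) = \<Lambda> h" if "h \<in> cyc N" for h
      using centred_bounds[OF that] mod_centred[OF that] by (simp add: unroll_def)
    ultimately show "(\<lambda>h\<in>cyc N. unroll N \<Lambda> (centred N h)) = \<Lambda>"
      by (intro extensionalityI[of _ "cyc N"]) auto
  qed
  show "\<forall>\<Lambda>\<in>cylindric_plane_partitions N. unroll N (\<lambda>h\<in>cyc N. \<Lambda> (centred N h)) = \<Lambda>"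
  proof
    fix \<Lambda> assume L: "\<Lambda> \<in> cylindric_plane_partitions N"
    then have "\<Lambda> \<in> extensional {- int N..int N}" and per: "\<Lambda> (- int N) = \<Lambda> (int N)"
      by (auto simp: cylindric_plane_partitions_def PiE_def)
    moreover have "unroll N (\<lambda>h\<in>cyc N. \<Lambda> (centred N h)) i = \<Lambda> i" if i: "i \<in> {- int N..int N}" for i
    proof (cases "i = int N")
      case True
      then show ?thesis using N per by (simp add: unroll_def N_mod cyc_def centred_def)
    next
      case False
      then have "centred N (i mod (2 * int N)) = i" using i by (intro centred_mod N) auto
      then show ?thesis using i mod_in_cyc[OF N] by (simp add: unroll_def)
    qed
    ultimately show "unroll N (\<lambda>h\<in>cyc N. \<Lambda> (centred N h)) = \<Lambda>"
      by (intro extensionalityI[of _ "{- int N..int N}"]) (auto simp: unroll_def)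
  qed
  show "unroll N ` configs N (up_steps N (pos N)) \<subseteq> cylindric_plane_partitions N"
  proof (rule image_subsetI)
    fix \<Lambda> assume L: "\<Lambda> \<in> configs N (up_steps N (pos N))"
    have rt: "(i + 1) mod (2 * int N) = rt N (i mod (2 * int N))" for i
      by (simp add: rt_def mod_simps)
    have step: "if int N \<le> h then \<Lambda> h \<prec> \<Lambda> (rt N h) else \<Lambda> (rt N h) \<prec> \<Lambda> h" if "h \<in> cyc N" for h
      using L that by (auto simp: configs_def up_steps_pos[OF N])
    have "unroll N \<Lambda> i \<prec> unroll N \<Lambda> (i + 1)" if i: "i \<in> {- int N..<0}" for i
    proof -
      have "int N \<le> i mod (2 * int N)" using i by (subst mod_cyc[OF N]) auto
      then show ?thesis
        using step[OF mod_in_cyc[OF N, of i]] i by (auto simp: unroll_def rt)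
    qed
    moreover have "unroll N \<Lambda> (i + 1) \<prec> unroll N \<Lambda> i" if i: "i \<in> {0..<int N}" for i
    proof -
      have "\<not> int N \<le> i mod (2 * int N)" using i by (subst mod_cyc[OF N]) auto
      then show ?thesis
        using step[OF mod_in_cyc[OF N, of i]] i by (auto simp: unroll_def rt simp del: mod_pos_pos_trivial)
    qed
    moreover have "unroll N \<Lambda> \<in> {- int N..int N} \<rightarrow>\<^sub>E partitions"
      using configs_partition[OF L mod_in_cyc[OF N]] by (auto simp: unroll_def)
    moreover have "unroll N \<Lambda> (- int N) = unroll N \<Lambda> (int N)"
      using N by (simp add: unroll_def N_mod)
    ultimately show "unroll N \<Lambda> \<in> cylindric_plane_partitions N"
      by (simp add: cylindric_plane_partitions_def)
  qed
  show "(\<lambda>\<Lambda>. \<lambda>h\<in>cyc N. \<Lambda> (centred N h)) ` cylindric_plane_partitions N \<subseteq> configs N (up_steps N (pos N))"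
  proof (rule image_subsetI)
    fix \<Lambda> assume L: "\<Lambda> \<in> cylindric_plane_partitions N"
    have up: "\<Lambda> i \<prec> \<Lambda> (i + 1)" if "i \<in> {- int N..<0}" for i
      using L that by (auto simp: cylindric_plane_partitions_def)
    have down: "\<Lambda> (i + 1) \<prec> \<Lambda> i" if "i \<in> {0..<int N}" for i
      using L that by (auto simp: cylindric_plane_partitions_def)
    have per: "\<Lambda> (- int N) = \<Lambda> (int N)" using L by (simp add: cylindric_plane_partitions_def)
    let ?F = "\<lambda>h\<in>cyc N. \<Lambda> (centred N h)"
    have "if h \<in> up_steps N (pos N) then ?F h \<prec> ?F (rt N h) else ?F (rt N h) \<prec> ?F h"
      if h: "h \<in> cyc N" for h
    proof -
      \<comment> \<open>To the right of \<open>int N - 1\<close> the representative jumps to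
        \<open>- int N\<close>; the equality of the two end partitions closes this gap.\<close>
      have succ: "?F (rt N h) = \<Lambda> (centred N h + 1)"
      proof (cases "h = int N - 1")
        case True
        have "rt N h = int N" using True N by (simp add: rt_def N_mod)
        then show ?thesis using True N per by (simp add: centred_def cyc_def)
      next
        case False
        then have "centred N (rt N h) = centred N h + 1"
          unfolding rt_eq[OF h] using h N by (auto simp: centred_def cyc_def)
        then show ?thesis using N by simp
      qed
      show ?thesis
        unfolding succ up_steps_pos[OF N] using h up[of "centred N h"] down[of "centred N h"]
        by (auto simp: centred_def cyc_def)
    qed
    moreover have "?F \<in> cyc N \<rightarrow>\<^sub>E partitions"
      using L centred_bounds[of _ N] by (fastforce simp: cylindric_plane_partitions_def)
    ultimately show "?F \<in> configs N (up_steps N (pos N))"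
      unfolding configs_def mem_Collect_eq by blast
  qed
qed

text \<open>The initial profile has its only local minimum at 0 and its only local maximum at
  \<open>int N\<close>, so beyond the factor \<open>q\<close> only the central and the end partition
  carry a weight.\<close>

lemma profile_weight_pos_eq:
  assumes N: "1 \<le> N" and aq: "0 < a" "0 < q" and h: "h \<in> cyc N"
  shows "profile_weight N a q (pos N) h =
    q * (if h = 0 then a else 1) * (if h = int N then inverse a * q powi (- int N) else 1)"
proof -
  have l: "pos N h < pos N (lt N h) \<longleftrightarrow> h = 0 \<or> int N < h"
    unfolding lt_eq[OF h] using N h by (auto simp: pos_def cyc_def)
  have r: "pos N (rt N h) < pos N h \<longleftrightarrow> int N \<le> h"
    unfolding rt_eq[OF h] using N h by (auto simp: pos_def cyc_def)
  have p: "pos N 0 = 0" "pos N (int N) = int N" by (auto simp: pos_def)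
  consider "h = 0" | "h = int N" | "int N < h" | "0 < h" "h < int N"
    using h by (fastforce simp: cyc_def)
  then show ?thesis
    using N aq unfolding profile_weight_def l r
    by cases (auto simp: p power_int_minus field_simps)
qed

lemma weight_pos_eq:
  assumes N: "1 \<le> N" and aq: "0 < a" "0 < q"
  shows "weight N (profile_weight N a q (pos N)) \<Lambda> = cpp_weight N a q (unroll N \<Lambda>)"
proof -
  have delta: "(\<Prod>k\<in>cyc N. (if k = j then x else 1) ^ psize (\<Lambda> k)) = x ^ psize (\<Lambda> j)"
    if "j \<in> cyc N" for j and x :: real
  proof -
    have "(\<Prod>k\<in>cyc N. (if k = j then x else 1) ^ psize (\<Lambda> k)) =
        (\<Prod>k\<in>cyc N. if k = j then x ^ psize (\<Lambda> k) else 1)"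
      by (intro prod.cong) auto
    then show ?thesis using that by (simp add: prod.delta)
  qed
  have "(\<Sum>i\<in>{- int N..<int N}. psize (unroll N \<Lambda> i)) = (\<Sum>h\<in>cyc N. psize (\<Lambda> h))"
    by (rule sum.reindex_bij_witness[where i = "centred N" and j = "\<lambda>i. i mod (2 * int N)"])
       (use N centred_mod mod_in_cyc mod_centred centred_bounds in \<open>auto simp: unroll_def\<close>)
  moreover have "unroll N \<Lambda> 0 = \<Lambda> 0" "unroll N \<Lambda> (int N) = \<Lambda> (int N)"
    using N by (simp_all add: unroll_def N_mod)
  moreover have "weight N (profile_weight N a q (pos N)) \<Lambda> =
      (\<Prod>h\<in>cyc N. q ^ psize (\<Lambda> h) * (if h = 0 then a else 1) ^ psize (\<Lambda> h) *
        (if h = int N then inverse a * q powi (- int N) else 1) ^ psize (\<Lambda> h))"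
    unfolding weight_def
    by (intro prod.cong refl) (simp only: profile_weight_pos_eq[OF N aq] power_mult_distrib)
  moreover have "0 \<in> cyc N" "int N \<in> cyc N" using N by (auto simp: cyc_def)
  ultimately show ?thesis
    unfolding cpp_weight_def prod.distrib by (simp only: delta power_sum mult_ac)
qed

section \<open>Measures on countable linear orders\<close>

text \<open>A singleton is a down-set minus countably many smaller ones, so down-sets generate all
  sets. The lemma is used for \<open>nat\<close> and for \<open>enat\<close>; in the latter, the
  case \<open>m = \<infinity>\<close> compares total masses.\<close>

lemma measure_eqI_atMost:
  fixes P Q :: "'a :: {linorder, countable} measure"
  assumes sets: "sets P = UNIV" "sets Q = UNIV"
    and eq: "\<And>m. emeasure P {..m} = emeasure Q {..m}" and fin: "\<And>m. emeasure P {..m} \<noteq> \<infinity>"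
  shows "P = Q"
proof (rule measure_eqI_generator_eq[where E = "range atMost" and \<Omega> = UNIV and A = "\<lambda>i. {..from_nat i}"])
  show "Int_stable (range atMost :: 'a set set)"
    by (auto simp: Int_stable_def)
  have "S \<in> sigma_sets UNIV (range atMost)" for S :: "'a set"
  proof -
    interpret sigma_algebra UNIV "sigma_sets UNIV (range atMost :: 'a set set)"
      by (rule sigma_algebra_sigma_sets) auto
    have "{x} \<in> sigma_sets UNIV (range atMost)" for x :: 'a
    proof -
      have "{x} = {..x} - (\<Union>y\<in>{..<x}. {..y})" by (auto simp: not_le) (metis lessThan_iff less_irrefl order_le_imp_less_or_eq)
      also have "\<dots> \<in> sigma_sets UNIV (range atMost)"
        by (intro Diff countable_UN') (auto intro: sigma_sets.Basic)
      finally show ?thesis .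
    qed
    then have "(\<Union>x\<in>S. {x}) \<in> sigma_sets UNIV (range atMost)"
      by (intro countable_UN') auto
    then show ?thesis by simp
  qed
  then have "sigma_sets UNIV (range atMost :: 'a set set) = UNIV" by auto
  then show "sets P = sigma_sets UNIV (range atMost)" "sets Q = sigma_sets UNIV (range atMost)"
    using sets by simp_all
  have "x \<in> (\<Union>i. {..from_nat i})" for x :: 'a
    using surj_from_nat by (metis UN_I UNIV_I atMost_iff order_refl surjD)
  then show "(\<Union>i. {..from_nat i :: 'a}) = UNIV" by blast
qed (use eq fin in auto)

lemma nn_integral_countable_measure:
  fixes P :: "nat measure"
  assumes "sets P = UNIV"
  shows "(\<integral>\<^sup>+x. f x \<partial>P) = (\<Sum>i. f i * emeasure P {i})"
proof -
  have meas: "g \<in> borel_measurable P" for g :: "nat \<Rightarrow> ennreal"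
    by (rule measurableI) (use assms in auto)
  have "(\<integral>\<^sup>+x. f x \<partial>P) = (\<integral>\<^sup>+x. (\<Sum>i. f i * indicator {i} x) \<partial>P)"
  proof (rule nn_integral_cong)
    fix x
    have "(\<Sum>i. f i * indicator {i} x) = (\<Sum>i\<in>{x}. f i * indicator {i} x)"
      by (rule suminf_finite) auto
    then show "f x = (\<Sum>i. f i * indicator {i} x)" by simp
  qed
  also have "\<dots> = (\<Sum>i. \<integral>\<^sup>+x. f i * indicator {i} x \<partial>P)"
    by (rule nn_integral_suminf) (rule meas)
  also have "\<dots> = (\<Sum>i. f i * emeasure P {i})"
    using assms by (simp add: nn_integral_cmult_indicator)
  finally show ?thesis .
qed

section \<open>The law of the largest part\<close>

context cylindric_lpp
begin

text \<open>At level 0 no random weight has entered: the event concerns the central first part alone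
  and is certain or impossible.\<close>

lemma partition_fun_cpp:
  "partition_fun 0 {} m =
    (\<integral>\<^sup>+\<Lambda>. ennreal (cpp_weight N a q \<Lambda>) * indicator {\<Lambda>. enat (\<Lambda> 0 0) \<le> m} \<Lambda>
      \<partial>count_space (cylindric_plane_partitions N))"
proof -
  have up: "up_steps N (time N 0 {}) = up_steps N (pos N)"
    by (intro up_steps_cong N time_0)
  have wt: "weight N (profile_weight N a q (time N 0 {})) \<Lambda> = cpp_weight N a q (unroll N \<Lambda>)" for \<Lambda>
    unfolding weight_pos_eq[OF N a(1) q(1), symmetric]
    by (intro weight_cong profile_weight_cong N time_0)
  have ev: "emeasure M (lpp_event 0 {} m (\<lambda>h. \<Lambda> h 0)) = indicator {\<Lambda>. enat (\<Lambda> 0 0) \<le> m} (unroll N \<Lambda>)" for \<Lambda>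
  proof -
    have "unroll N \<Lambda> 0 = \<Lambda> 0" by (simp add: unroll_def)
    then show ?thesis by (simp add: lpp_event_def lpp_le_0 emeasure_space_1 indicator_def)
  qed
  show ?thesis
    unfolding partition_fun_def up wt ev
    by (rule nn_integral_bij_count_space[OF bij_betw_unroll[OF N]])
qed

text \<open>For \<open>m = \<infinity>\<close> this says that \<open>cpp_law N a q\<close> has total
  mass 1, that is, \<open>cpp_Z N a q\<close> is the right normalization.\<close>

lemma emeasure_cpp_law:
  "emeasure (cpp_law N a q) {\<Lambda> \<in> cylindric_plane_partitions N. enat (\<Lambda> 0 0) \<le> m} =
    (\<integral>\<^sup>+\<kappa>. emeasure M (passage_le (\<kappa> 0) m) \<partial>partition_law (q ^ N))"
proof -
  have Z: "cpp_Z N a q > 0" by (rule cpp_Z_pos[OF N a q])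
  have "ennreal (cpp_weight N a q \<Lambda> / cpp_Z N a q) = ennreal (1 / cpp_Z N a q) * ennreal (cpp_weight N a q \<Lambda>)" for \<Lambda>
    using Z by (subst ennreal_mult'[symmetric]) auto
  then have "emeasure (cpp_law N a q) {\<Lambda> \<in> cylindric_plane_partitions N. enat (\<Lambda> 0 0) \<le> m} =
    (\<integral>\<^sup>+\<Lambda>. ennreal (1 / cpp_Z N a q) * (ennreal (cpp_weight N a q \<Lambda>) * indicator {\<Lambda>. enat (\<Lambda> 0 0) \<le> m} \<Lambda>)
      \<partial>count_space (cylindric_plane_partitions N))"
    unfolding cpp_law_def point_measure_def
    by (subst emeasure_density) (auto intro!: nn_integral_cong simp: mult.assoc indicator_def)
  also have "\<dots> = ennreal (1 / cpp_Z N a q) * partition_fun 0 {} m"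
    unfolding partition_fun_cpp by (rule nn_integral_cmult) simp
  also have "ennreal (1 / cpp_Z N a q) * partition_fun 0 {} m =
      ennreal (1 / cpp_Z N a q * cpp_Z N a q) *
        (\<integral>\<^sup>+\<kappa>. emeasure M (passage_le (\<kappa> 0) m) \<partial>partition_law (q ^ N))"
    unfolding partition_fun_eq mult.assoc[symmetric] using Z by (subst ennreal_mult) simp_all
  also have "1 / cpp_Z N a q * cpp_Z N a q = 1" using Z by simp
  finally show ?thesis by simp
qed

end

theorem theorem9:
  fixes N :: nat and a q :: real
    and M :: "'a measure"
    and w :: "int \<times> nat \<Rightarrow> 'a \<Rightarrow> nat"
    and L :: "'a \<Rightarrow> enat"
    and X :: "'a \<Rightarrow> nat"
  assumes "1 \<le> N" and "0 < a" "a < 1" and "0 < q" "q < 1"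
    and "prob_space M"
    and "prob_space.indep_vars M (\<lambda>_. count_space UNIV) w (squares N)"
    and "\<And>h k. (h, k) \<in> squares N \<Longrightarrow>
           distr M (count_space UNIV) (w (h, k)) = measure_pmf (Geom (a * q ^ k))"
    and "\<And>\<omega>. L \<omega> = last_passage_time N (\<lambda>s. w s \<omega>)"
    and "prob_space.indep_var M (count_space UNIV) L (count_space UNIV) (\<lambda>\<omega>. enat (X \<omega>))"
    and "\<And>m. measure M {\<omega> \<in> space M. X \<omega> \<le> m} = qpoch (q ^ (N * (m + 1))) (q ^ N)"
  shows "distr M (count_space UNIV) (\<lambda>\<omega>. L \<omega> + enat (X \<omega>)) =
           distr (cpp_law N a q) (count_space UNIV) (\<lambda>\<Lambda>. enat (\<Lambda> 0 0)) \<and>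
         distr M (count_space UNIV) X =
           distr (partition_law (q ^ N)) (count_space UNIV) (\<lambda>\<kappa>. \<kappa> 0)"
proof -
  interpret prob_space M by fact
  interpret cylindric_lpp M N a q w by unfold_locales (use assms in auto)
  have u: "0 < q ^ N" "q ^ N < 1" using q N by (auto simp: power_less_one_iff)
  have L[measurable]: "L \<in> M \<rightarrow>\<^sub>M count_space UNIV"
    and eX: "(\<lambda>\<omega>. enat (X \<omega>)) \<in> M \<rightarrow>\<^sub>M count_space UNIV"
    using indep_var_rv1[OF assms(10)] indep_var_rv2[OF assms(10)] by auto
  have X: "X \<in> M \<rightarrow>\<^sub>M count_space UNIV"
    using measurable_compose[OF eX, of the_enat "count_space UNIV"] by simp
  have space_pl: "space (partition_law (q ^ N)) = partitions"
    by (simp add: partition_law_def space_point_measure)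
  have k0: "(\<lambda>\<kappa>. \<kappa> 0) \<in> partition_law (q ^ N) \<rightarrow>\<^sub>M count_space UNIV"
    by (simp add: partition_law_def point_measure_def)
  have distr_X: "distr M (count_space UNIV) X = distr (partition_law (q ^ N)) (count_space UNIV) (\<lambda>\<kappa>. \<kappa> 0)"
  proof (rule measure_eqI_atMost)
    fix m
    have "X -` {..m} \<inter> space M = {\<omega> \<in> space M. X \<omega> \<le> m}" by auto
    then have l: "emeasure (distr M (count_space UNIV) X) {..m} = ennreal (qpoch (q ^ (N * (m + 1))) (q ^ N))"
      using X by (simp only: emeasure_distr emeasure_eq_measure assms(11) sets_count_space Pow_UNIV UNIV_I)
    have "(\<lambda>\<kappa>. \<kappa> 0) -` {..m} \<inter> partitions = {\<kappa> \<in> partitions. \<kappa> 0 \<le> m}" by auto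
    then have "emeasure (distr (partition_law (q ^ N)) (count_space UNIV) (\<lambda>\<kappa>. \<kappa> 0)) {..m} =
        ennreal (qpoch ((q ^ N) ^ (m + 1)) (q ^ N))"
      using k0 u by (simp only: emeasure_distr space_pl emeasure_partition_law_le sets_count_space Pow_UNIV UNIV_I)
    then show "emeasure (distr M (count_space UNIV) X) {..m} =
        emeasure (distr (partition_law (q ^ N)) (count_space UNIV) (\<lambda>\<kappa>. \<kappa> 0)) {..m}"
      using l by (simp only: power_mult)
    show "emeasure (distr M (count_space UNIV) X) {..m} \<noteq> \<infinity>" using l by simp
  qed auto
  have passage: "passage_le x m = L -` {l. l + enat x \<le> m} \<inter> space M" for x m
    by (auto simp: passage_le_def assms(9))
  have "distr M (count_space UNIV) (\<lambda>\<omega>. L \<omega> + enat (X \<omega>)) =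
      distr (cpp_law N a q) (count_space UNIV) (\<lambda>\<Lambda>. enat (\<Lambda> 0 0))"
  proof (rule measure_eqI_atMost)
    fix m
    have LX: "(\<lambda>\<omega>. L \<omega> + enat (X \<omega>)) \<in> M \<rightarrow>\<^sub>M count_space UNIV"
      using L eX by measurable
    \<comment> \<open>Splitting by the value \<open>x\<close> of \<open>X\<close> leaves a condition
      on \<open>L\<close> alone, to which independence applies.\<close>
    let ?E = "\<lambda>x. (\<lambda>\<omega>. (L \<omega>, enat (X \<omega>))) -` ({l. l + enat x \<le> m} \<times> {enat x}) \<inter> space M"
    have E: "?E x = (L -` {l. l + enat x \<le> m} \<inter> space M) \<inter> (X -` {x} \<inter> space M)" for x by auto
    have "emeasure M (?E x) = emeasure M (passage_le x m) * emeasure (distr M (count_space UNIV) X) {x}" for x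
    proof -
      have "prob (?E x) = prob (passage_le x m) * prob ((\<lambda>\<omega>. enat (X \<omega>)) -` {enat x} \<inter> space M)"
        unfolding passage by (rule indep_varD[OF assms(10)]) auto
      moreover have "(\<lambda>\<omega>. enat (X \<omega>)) -` {enat x} \<inter> space M = X -` {x} \<inter> space M" by auto
      ultimately show ?thesis
        using X by (simp add: emeasure_distr emeasure_eq_measure ennreal_mult)
    qed
    moreover have "?E x \<in> events" for x
      unfolding E by (rule sets.Int[OF measurable_sets[OF L] measurable_sets[OF X]]) auto
    moreover have "(\<lambda>\<omega>. L \<omega> + enat (X \<omega>)) -` {..m} \<inter> space M = (\<Union>x. ?E x)" by auto
    moreover have "disjoint_family ?E" by (auto simp: disjoint_family_on_def)
    ultimately have "emeasure (distr M (count_space UNIV) (\<lambda>\<omega>. L \<omega> + enat (X \<omega>))) {..m} =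
        (\<Sum>x. emeasure M (passage_le x m) * emeasure (distr M (count_space UNIV) X) {x})"
      using LX suminf_emeasure[of ?E M] by (simp add: emeasure_distr image_subset_iff)
    also have "\<dots> = (\<integral>\<^sup>+x. emeasure M (passage_le x m) \<partial>distr M (count_space UNIV) X)"
      by (rule nn_integral_countable_measure[symmetric]) simp
    \<comment> \<open>Replacing \<open>X\<close> by the first part of a random partition yields the
      integral that the limit produced.\<close>
    also have "\<dots> = (\<integral>\<^sup>+\<kappa>. emeasure M (passage_le (\<kappa> 0) m) \<partial>partition_law (q ^ N))"
      unfolding distr_X using k0 by (subst nn_integral_distr) auto
    also have "\<dots> = emeasure (cpp_law N a q) {\<Lambda> \<in> cylindric_plane_partitions N. enat (\<Lambda> 0 0) \<le> m}"
      by (rule emeasure_cpp_law[symmetric])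
    also have "{\<Lambda> \<in> cylindric_plane_partitions N. enat (\<Lambda> 0 0) \<le> m} =
        (\<lambda>\<Lambda>. enat (\<Lambda> 0 0)) -` {..m} \<inter> space (cpp_law N a q)"
      by (auto simp: cpp_law_def space_point_measure)
    also have "emeasure (cpp_law N a q) \<dots> =
        emeasure (distr (cpp_law N a q) (count_space UNIV) (\<lambda>\<Lambda>. enat (\<Lambda> 0 0))) {..m}"
      by (rule emeasure_distr[symmetric]) (auto simp: cpp_law_def point_measure_def)
    finally show "emeasure (distr M (count_space UNIV) (\<lambda>\<omega>. L \<omega> + enat (X \<omega>))) {..m} =
        emeasure (distr (cpp_law N a q) (count_space UNIV) (\<lambda>\<Lambda>. enat (\<Lambda> 0 0))) {..m}" .
    show "emeasure (distr M (count_space UNIV) (\<lambda>\<omega>. L \<omega> + enat (X \<omega>))) {..m} \<noteq> \<infinity>"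
      using LX by (simp add: emeasure_distr)
  qed auto
  with distr_X show ?thesis by blast
qed

end
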